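(* Let $(M^{2n+1},\phi,\xi,\eta,g)$ be an almost $\alpha$-para-Kenmotsu manifold. Then, for every vector field $X$ on $M$, $$R(\xi,X)\xi=\alpha^2\phi^2X+2\alpha\phi hX-h^2X+\phi(\nabla_\xi h)X,$$ $$(\nabla_\xi h)X=-\alpha^2\phi X-2\alpha hX+\phi h^2X-\phi R(X,\xi)\xi,$$ $$\tfrac12\bigl(R(\xi,X)\xi+\phi R(\xi,\phi X)\xi\bigr)=\alpha^2\phi^2X-h^2X,$$ $$S(X,\xi)=-2n\alpha^2\eta(X)+g(\mathrm{div}(\phi h),X),$$ $$S(\xi,\xi)=-2n\alpha^2+\mathrm{tr}\,h^2 .$$
   Context: An almost paracontact metric manifold is a smooth manifold $M$ of dimension $2n+1$ with a $(1,1)$-tensor field $\phi$, a vector field $\xi$, a 1-form $\eta$ and a pseudo-Riemannian metric $g$ of signature $(n+1,n)$ such that $\eta(\xi)=1$, $\phi^2=\mathrm{Id}-\eta\otimes\xi$, the eigendistributions of $\phi|_{\ker\eta}$ for the eigenvalues $+1$ and $-1$ both have rank $n$, and $g(\phi X,\phi Y)=-g(X,Y)+\eta(X)\eta(Y)$ (hence $\eta(X)=g(X,\xi)$, $\phi\xi=0$, $\eta\circ\phi=0$). Its fundamental 2-form is $\Phi(X,Y)=g(\phi X,Y)$. It is almost $\alpha$-para-Kenmotsu, where $\alpha$ is a real constant, if $d\eta=0$ and $d\Phi=2\alpha\,\eta\wedge\Phi$ (with $d$ and $\wedge$ normalized compatibly, so that the cyclic sum of $(\nabla_X\Phi)(Y,Z)$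 equals $2\alpha$ times the cyclic sum of $\eta(X)\Phi(Y,Z)$). $\nabla$ is the Levi-Civita connection of $g$, $R(X,Y)Z=\nabla_X\nabla_YZ-\nabla_Y\nabla_XZ-\nabla_{[X,Y]}Z$, $S(Y,Z)=\mathrm{tr}(X\mapsto R(X,Y)Z)$ is the Ricci tensor, $h=\frac12\mathcal{L}_\xi\phi$ (Lie derivative), and for a $(1,1)$-tensor field $T$, $\mathrm{div}\,T=\sum_i\varepsilon_i(\nabla_{E_i}T)E_i$ for a local pseudo-orthonormal frame $E_i$ with $\varepsilon_i=g(E_i,E_i)=\pm1$. *)

theory Defs
  imports "HOL-Analysis.Analysis"
begin

section \<open>Smooth maps on open subsets of Euclidean space\<close>

primrec Ck_on :: "nat \<Rightarrow> 'a::euclidean_space set \<Rightarrow> ('a \<Rightarrow> 'b::real_normed_vector) \<Rightarrow> bool" where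
  "Ck_on 0 S f \<longleftrightarrow> continuous_on S f"
| "Ck_on (Suc k) S f \<longleftrightarrow>
     f differentiable_on S \<and> (\<forall>v. Ck_on k S (\<lambda>x. frechet_derivative f (at x) v))"

text \<open>Only used for open \<open>S\<close>.\<close>
definition smooth_on :: "'a::euclidean_space set \<Rightarrow> ('a \<Rightarrow> 'b::real_normed_vector) \<Rightarrow> bool" where
  "smooth_on S f \<longleftrightarrow> (\<forall>k. Ck_on k S f)"

section \<open>Smooth manifolds\<close>

text \<open>The manifold is the whole type \<open>'m\<close> (Hausdorff and second countable through its type
  class), modelled on \<open>real ^ 'k\<close>. A chart is a pair of its domain and its coordinate map.\<close>

type_synonym ('m, 'k) chart = "'m set \<times> ('m \<Rightarrow> real ^ 'k)"

definition cdom :: "('m, 'k) chart \<Rightarrow> 'm set" where "cdom c = fst c"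
definition cmap :: "('m, 'k) chart \<Rightarrow> 'm \<Rightarrow> real ^ 'k" where "cmap c = snd c"
definition cinv :: "('m, 'k) chart \<Rightarrow> real ^ 'k \<Rightarrow> 'm" where "cinv c = inv_into (cdom c) (cmap c)"

definition smooth_atlas :: "('m::topological_space, 'k::finite) chart set \<Rightarrow> bool" where
  "smooth_atlas A \<longleftrightarrow>
     (\<forall>c\<in>A. open (cdom c) \<and> open (cmap c ` cdom c) \<and>
        homeomorphism (cdom c) (cmap c ` cdom c) (cmap c) (cinv c)) \<and>
     (\<Union>c\<in>A. cdom c) = UNIV \<and>
     (\<forall>c\<in>A. \<forall>d\<in>A. smooth_on (cmap c ` (cdom c \<inter> cdom d)) (cmap d \<circ> cinv c))"

text \<open>A preferred chart around every point is chosen, and the tangent space at \<open>p\<close> is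
  \<open>real ^ 'k\<close>, read as the components of tangent vectors with respect to the preferred chart
  at \<open>p\<close>. The components with respect to any other chart \<open>c\<close> are obtained by applying
  the differential of the coordinate change, \<open>comps A c p\<close>. Note that the components of a
  vector field in this sense are not continuous in \<open>p\<close> in general, because the preferred
  chart jumps; smoothness is therefore always tested in a fixed chart.\<close>

definition chart_at :: "('m, 'k) chart set \<Rightarrow> 'm \<Rightarrow> ('m, 'k) chart" where
  "chart_at A p = (SOME c. c \<in> A \<and> p \<in> cdom c)"

definition comps ::
  "('m, 'k::finite) chart set \<Rightarrow> ('m, 'k) chart \<Rightarrow> 'm \<Rightarrow> real ^ 'k \<Rightarrow> real ^ 'k" where
  "comps A c p =
     frechet_derivative (cmap c \<circ> cinv (chart_at A p)) (at (cmap (chart_at A p) p))"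

type_synonym ('m, 'k) vfield = "'m \<Rightarrow> real ^ 'k"

definition rep :: "('m, 'k::finite) chart set \<Rightarrow> ('m, 'k) chart \<Rightarrow> ('m, 'k) vfield
    \<Rightarrow> real ^ 'k \<Rightarrow> real ^ 'k" where
  "rep A c X y = comps A c (cinv c y) (X (cinv c y))"

definition smooth_fun :: "('m, 'k::finite) chart set \<Rightarrow> 'm set \<Rightarrow> ('m \<Rightarrow> real) \<Rightarrow> bool" where
  "smooth_fun A U f \<longleftrightarrow> (\<forall>c\<in>A. smooth_on (cmap c ` (U \<inter> cdom c)) (f \<circ> cinv c))"

definition smooth_vf :: "('m, 'k::finite) chart set \<Rightarrow> 'm set \<Rightarrow> ('m, 'k) vfield \<Rightarrow> bool" where
  "smooth_vf A U X \<longleftrightarrow> (\<forall>c\<in>A. smooth_on (cmap c ` (U \<inter> cdom c)) (rep A c X))"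

text \<open>The derivative \<open>X f\<close> of a function along a vector field.\<close>
definition vf_deriv :: "('m, 'k::finite) chart set \<Rightarrow> ('m, 'k) vfield \<Rightarrow> ('m \<Rightarrow> real) \<Rightarrow> 'm \<Rightarrow> real" where
  "vf_deriv A X f p =
     frechet_derivative (f \<circ> cinv (chart_at A p)) (at (cmap (chart_at A p) p)) (X p)"

definition lie_bracket :: "('m, 'k::finite) chart set \<Rightarrow> ('m, 'k) vfield \<Rightarrow> ('m, 'k) vfield
    \<Rightarrow> ('m, 'k) vfield" where
  "lie_bracket A X Y p = (let c = chart_at A p; x = cmap c p in
     frechet_derivative (rep A c Y) (at x) (X p) - frechet_derivative (rep A c X) (at x) (Y p))"

section \<open>Tensor fields\<close>

definition act :: "('m \<Rightarrow> real ^ 'k \<Rightarrow> real ^ 'k) \<Rightarrow> ('m, 'k) vfield \<Rightarrow> ('m, 'k) vfield" where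
  "act T X p = T p (X p)"

text \<open>Smoothness of tensor fields is tested on smooth vector fields on all open subsets.\<close>

definition smooth_tensor11 :: "('m::topological_space, 'k::finite) chart set
    \<Rightarrow> ('m \<Rightarrow> real ^ 'k \<Rightarrow> real ^ 'k) \<Rightarrow> bool" where
  "smooth_tensor11 A T \<longleftrightarrow> (\<forall>p. linear (T p)) \<and>
     (\<forall>U X. open U \<longrightarrow> smooth_vf A U X \<longrightarrow> smooth_vf A U (act T X))"

definition smooth_form1 :: "('m::topological_space, 'k::finite) chart set
    \<Rightarrow> ('m \<Rightarrow> real ^ 'k \<Rightarrow> real) \<Rightarrow> bool" where
  "smooth_form1 A \<eta> \<longleftrightarrow> (\<forall>p. linear (\<eta> p)) \<and>
     (\<forall>U X. open U \<longrightarrow> smooth_vf A U X \<longrightarrow> smooth_fun A U (\<lambda>p. \<eta> p (X p)))"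

definition smooth_tensor02 :: "('m::topological_space, 'k::finite) chart set
    \<Rightarrow> ('m \<Rightarrow> real ^ 'k \<Rightarrow> real ^ 'k \<Rightarrow> real) \<Rightarrow> bool" where
  "smooth_tensor02 A B \<longleftrightarrow> (\<forall>p. bilinear (B p)) \<and>
     (\<forall>U X Y. open U \<longrightarrow> smooth_vf A U X \<longrightarrow> smooth_vf A U Y \<longrightarrow>
        smooth_fun A U (\<lambda>p. B p (X p) (Y p)))"

definition has_signature :: "(real ^ 'k \<Rightarrow> real ^ 'k \<Rightarrow> real) \<Rightarrow> nat \<Rightarrow> nat \<Rightarrow> bool" where
  "has_signature B r s \<longleftrightarrow> (\<exists>e :: 'k::finite \<Rightarrow> real ^ 'k.
     (\<forall>i j. i \<noteq> j \<longrightarrow> B (e i) (e j) = 0) \<and>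
     (\<forall>i. B (e i) (e i) = 1 \<or> B (e i) (e i) = -1) \<and>
     card {i. B (e i) (e i) = 1} = r \<and> card {i. B (e i) (e i) = -1} = s)"

definition pseudo_riemannian :: "('m::topological_space, 'k::finite) chart set
    \<Rightarrow> ('m \<Rightarrow> real ^ 'k \<Rightarrow> real ^ 'k \<Rightarrow> real) \<Rightarrow> nat \<Rightarrow> nat \<Rightarrow> bool" where
  "pseudo_riemannian A g r s \<longleftrightarrow> smooth_tensor02 A g \<and>
     (\<forall>p u v. g p u v = g p v u) \<and> (\<forall>p. has_signature (g p) r s)"

text \<open>A general (1,1)-tensor field is handled as an operator \<open>F\<close> on vector fields. As such an
  operator is tensorial, its value on a tangent vector \<open>v\<close> at \<open>p\<close> is \<open>F V p\<close> for any smooth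
  vector field \<open>V\<close> defined near \<open>p\<close> with \<open>V p = v\<close>. We take for \<open>V\<close> the field with constant
  components \<open>v\<close> in the preferred chart at \<open>p\<close>, which is smooth on the domain of that chart.\<close>

definition extend :: "('m, 'k::finite) chart set \<Rightarrow> 'm \<Rightarrow> real ^ 'k \<Rightarrow> ('m, 'k) vfield" where
  "extend A p v q =
     frechet_derivative (cmap (chart_at A q) \<circ> cinv (chart_at A p)) (at (cmap (chart_at A p) q)) v"

definition tensor_trace :: "('m, 'k::finite) chart set
    \<Rightarrow> (('m, 'k) vfield \<Rightarrow> ('m, 'k) vfield) \<Rightarrow> 'm \<Rightarrow> real" where
  "tensor_trace A F p = trace (matrix (\<lambda>v. F (extend A p v) p))"

definition lie_deriv11 :: "('m, 'k::finite) chart set \<Rightarrow> ('m, 'k) vfield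
    \<Rightarrow> (('m, 'k) vfield \<Rightarrow> ('m, 'k) vfield) \<Rightarrow> ('m, 'k) vfield \<Rightarrow> ('m, 'k) vfield" where
  "lie_deriv11 A X F Y p = lie_bracket A X (F Y) p - F (lie_bracket A X Y) p"

section \<open>Differential forms\<close>

text \<open>Normalization: no factors 1/2 or 1/3, neither in the exterior derivative nor in the
  wedge product.\<close>

definition d_form1 :: "('m, 'k::finite) chart set \<Rightarrow> ('m \<Rightarrow> real ^ 'k \<Rightarrow> real)
    \<Rightarrow> ('m, 'k) vfield \<Rightarrow> ('m, 'k) vfield \<Rightarrow> 'm \<Rightarrow> real" where
  "d_form1 A \<eta> X Y p =
     vf_deriv A X (\<lambda>q. \<eta> q (Y q)) p - vf_deriv A Y (\<lambda>q. \<eta> q (X q)) p - \<eta> p (lie_bracket A X Y p)"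

definition d_form2 :: "('m, 'k::finite) chart set \<Rightarrow> ('m \<Rightarrow> real ^ 'k \<Rightarrow> real ^ 'k \<Rightarrow> real)
    \<Rightarrow> ('m, 'k) vfield \<Rightarrow> ('m, 'k) vfield \<Rightarrow> ('m, 'k) vfield \<Rightarrow> 'm \<Rightarrow> real" where
  "d_form2 A \<omega> X Y Z p =
     vf_deriv A X (\<lambda>q. \<omega> q (Y q) (Z q)) p
     + vf_deriv A Y (\<lambda>q. \<omega> q (Z q) (X q)) p
     + vf_deriv A Z (\<lambda>q. \<omega> q (X q) (Y q)) p
     - \<omega> p (lie_bracket A X Y p) (Z p)
     - \<omega> p (lie_bracket A Y Z p) (X p)
     - \<omega> p (lie_bracket A Z X p) (Y p)"

definition wedge12 :: "('m \<Rightarrow> real ^ 'k \<Rightarrow> real) \<Rightarrow> ('m \<Rightarrow> real ^ 'k \<Rightarrow> real ^ 'k \<Rightarrow> real)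
    \<Rightarrow> ('m, 'k) vfield \<Rightarrow> ('m, 'k) vfield \<Rightarrow> ('m, 'k) vfield \<Rightarrow> 'm \<Rightarrow> real" where
  "wedge12 \<eta> \<omega> X Y Z p =
     \<eta> p (X p) * \<omega> p (Y p) (Z p) + \<eta> p (Y p) * \<omega> p (Z p) (X p) + \<eta> p (Z p) * \<omega> p (X p) (Y p)"

section \<open>Levi-Civita connection and curvature\<close>

text \<open>A connection acts on smooth vector fields on open subsets, as is needed to apply it to
  local frames. Values of \<open>nabla\<close> outside the set where its arguments are smooth are irrelevant.\<close>

definition affine_connection :: "('m::topological_space, 'k::finite) chart set
    \<Rightarrow> (('m, 'k) vfield \<Rightarrow> ('m, 'k) vfield \<Rightarrow> ('m, 'k) vfield) \<Rightarrow> bool" where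
  "affine_connection A nabla \<longleftrightarrow>
     (\<forall>U X Y Z f. open U \<longrightarrow> smooth_vf A U X \<longrightarrow> smooth_vf A U Y \<longrightarrow> smooth_vf A U Z \<longrightarrow>
        smooth_fun A U f \<longrightarrow>
        smooth_vf A U (nabla X Y) \<and>
        (\<forall>p\<in>U. nabla (\<lambda>q. X q + Y q) Z p = nabla X Z p + nabla Y Z p \<and>
               nabla (\<lambda>q. f q *\<^sub>R X q) Y p = f p *\<^sub>R nabla X Y p \<and>
               nabla X (\<lambda>q. Y q + Z q) p = nabla X Y p + nabla X Z p \<and>
               nabla X (\<lambda>q. f q *\<^sub>R Y q) p = vf_deriv A X f p *\<^sub>R Y p + f p *\<^sub>R nabla X Y p))"

definition levi_civita :: "('m::topological_space, 'k::finite) chart set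
    \<Rightarrow> ('m \<Rightarrow> real ^ 'k \<Rightarrow> real ^ 'k \<Rightarrow> real)
    \<Rightarrow> (('m, 'k) vfield \<Rightarrow> ('m, 'k) vfield \<Rightarrow> ('m, 'k) vfield) \<Rightarrow> bool" where
  "levi_civita A g nabla \<longleftrightarrow> affine_connection A nabla \<and>
     (\<forall>U X Y Z. open U \<longrightarrow> smooth_vf A U X \<longrightarrow> smooth_vf A U Y \<longrightarrow> smooth_vf A U Z \<longrightarrow>
        (\<forall>p\<in>U. nabla X Y p - nabla Y X p = lie_bracket A X Y p \<and>
               vf_deriv A X (\<lambda>q. g q (Y q) (Z q)) p = g p (nabla X Y p) (Z p) + g p (Y p) (nabla X Z p)))"

definition curvature :: "('m, 'k::finite) chart set
    \<Rightarrow> (('m, 'k) vfield \<Rightarrow> ('m, 'k) vfield \<Rightarrow> ('m, 'k) vfield)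
    \<Rightarrow> ('m, 'k) vfield \<Rightarrow> ('m, 'k) vfield \<Rightarrow> ('m, 'k) vfield \<Rightarrow> ('m, 'k) vfield" where
  "curvature A nabla X Y Z p =
     nabla X (nabla Y Z) p - nabla Y (nabla X Z) p - nabla (lie_bracket A X Y) Z p"

definition ricci :: "('m, 'k::finite) chart set
    \<Rightarrow> (('m, 'k) vfield \<Rightarrow> ('m, 'k) vfield \<Rightarrow> ('m, 'k) vfield)
    \<Rightarrow> ('m, 'k) vfield \<Rightarrow> ('m, 'k) vfield \<Rightarrow> 'm \<Rightarrow> real" where
  "ricci A nabla Y Z = tensor_trace A (\<lambda>X. curvature A nabla X Y Z)"

definition cov_deriv11 :: "(('m, 'k::finite) vfield \<Rightarrow> ('m, 'k) vfield \<Rightarrow> ('m, 'k) vfield)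
    \<Rightarrow> ('m, 'k) vfield \<Rightarrow> (('m, 'k) vfield \<Rightarrow> ('m, 'k) vfield)
    \<Rightarrow> ('m, 'k) vfield \<Rightarrow> ('m, 'k) vfield" where
  "cov_deriv11 nabla X F Y p = nabla X (F Y) p - F (nabla X Y) p"

definition pseudo_orthonormal_frame :: "('m::topological_space, 'k::finite) chart set
    \<Rightarrow> ('m \<Rightarrow> real ^ 'k \<Rightarrow> real ^ 'k \<Rightarrow> real) \<Rightarrow> 'm set \<Rightarrow> ('k \<Rightarrow> ('m, 'k) vfield) \<Rightarrow> bool" where
  "pseudo_orthonormal_frame A g U E \<longleftrightarrow> open U \<and> (\<forall>i. smooth_vf A U (E i)) \<and>
     (\<forall>p\<in>U. (\<forall>i j. i \<noteq> j \<longrightarrow> g p (E i p) (E j p) = 0) \<and>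
            (\<forall>i. g p (E i p) (E i p) = 1 \<or> g p (E i p) (E i p) = -1))"

text \<open>The value does not depend on the chosen local frame.\<close>
definition divergence11 :: "('m::topological_space, 'k::finite) chart set
    \<Rightarrow> ('m \<Rightarrow> real ^ 'k \<Rightarrow> real ^ 'k \<Rightarrow> real)
    \<Rightarrow> (('m, 'k) vfield \<Rightarrow> ('m, 'k) vfield \<Rightarrow> ('m, 'k) vfield)
    \<Rightarrow> (('m, 'k) vfield \<Rightarrow> ('m, 'k) vfield) \<Rightarrow> ('m, 'k) vfield" where
  "divergence11 A g nabla F p =
     (let E = (SOME E. \<exists>U. p \<in> U \<and> pseudo_orthonormal_frame A g U E)
      in \<Sum>i\<in>UNIV. g p (E i p) (E i p) *\<^sub>R cov_deriv11 nabla (E i) F (E i) p)"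

section \<open>Almost paracontact metric structures\<close>

definition almost_paracontact_metric :: "('m::topological_space, 'k::finite) chart set \<Rightarrow> nat
    \<Rightarrow> ('m \<Rightarrow> real ^ 'k \<Rightarrow> real ^ 'k) \<Rightarrow> ('m, 'k) vfield \<Rightarrow> ('m \<Rightarrow> real ^ 'k \<Rightarrow> real)
    \<Rightarrow> ('m \<Rightarrow> real ^ 'k \<Rightarrow> real ^ 'k \<Rightarrow> real) \<Rightarrow> bool" where
  "almost_paracontact_metric A n \<phi> \<xi> \<eta> g \<longleftrightarrow>
     smooth_atlas A \<and> CARD('k) = 2 * n + 1 \<and>
     smooth_tensor11 A \<phi> \<and> smooth_vf A UNIV \<xi> \<and> smooth_form1 A \<eta> \<and>
     pseudo_riemannian A g (n + 1) n \<and>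
     (\<forall>p. \<eta> p (\<xi> p) = 1) \<and>
     (\<forall>p v. \<phi> p (\<phi> p v) = v - \<eta> p v *\<^sub>R \<xi> p) \<and>
     (\<forall>p. dim {v. \<eta> p v = 0 \<and> \<phi> p v = v} = n \<and> dim {v. \<eta> p v = 0 \<and> \<phi> p v = - v} = n) \<and>
     (\<forall>p u v. g p (\<phi> p u) (\<phi> p v) = - g p u v + \<eta> p u * \<eta> p v)"

definition fundamental_form :: "('m \<Rightarrow> real ^ 'k \<Rightarrow> real ^ 'k)
    \<Rightarrow> ('m \<Rightarrow> real ^ 'k \<Rightarrow> real ^ 'k \<Rightarrow> real) \<Rightarrow> 'm \<Rightarrow> real ^ 'k \<Rightarrow> real ^ 'k \<Rightarrow> real" where
  "fundamental_form \<phi> g p u v = g p (\<phi> p u) v"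

definition almost_para_Kenmotsu :: "('m::topological_space, 'k::finite) chart set \<Rightarrow> nat \<Rightarrow> real
    \<Rightarrow> ('m \<Rightarrow> real ^ 'k \<Rightarrow> real ^ 'k) \<Rightarrow> ('m, 'k) vfield \<Rightarrow> ('m \<Rightarrow> real ^ 'k \<Rightarrow> real)
    \<Rightarrow> ('m \<Rightarrow> real ^ 'k \<Rightarrow> real ^ 'k \<Rightarrow> real) \<Rightarrow> bool" where
  "almost_para_Kenmotsu A n \<alpha> \<phi> \<xi> \<eta> g \<longleftrightarrow> almost_paracontact_metric A n \<phi> \<xi> \<eta> g \<and>
     (\<forall>U X Y. open U \<longrightarrow> smooth_vf A U X \<longrightarrow> smooth_vf A U Y \<longrightarrow> (\<forall>p\<in>U. d_form1 A \<eta> X Y p = 0)) \<and>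
     (\<forall>U X Y Z. open U \<longrightarrow> smooth_vf A U X \<longrightarrow> smooth_vf A U Y \<longrightarrow> smooth_vf A U Z \<longrightarrow>
        (\<forall>p\<in>U. d_form2 A (fundamental_form \<phi> g) X Y Z p
                = 2 * \<alpha> * wedge12 \<eta> (fundamental_form \<phi> g) X Y Z p))"

definition structure_h :: "('m, 'k::finite) chart set \<Rightarrow> ('m \<Rightarrow> real ^ 'k \<Rightarrow> real ^ 'k)
    \<Rightarrow> ('m, 'k) vfield \<Rightarrow> ('m, 'k) vfield \<Rightarrow> ('m, 'k) vfield" where
  "structure_h A \<phi> \<xi> X p = (1 / 2) *\<^sub>R lie_deriv11 A \<xi> (act \<phi>) X p"

end

theory Submission
  imports Defs
begin

text \<open>Write \<open>L X = nabla X \<xi>\<close> for the shape operator of \<open>\<xi>\<close>. Closedness of \<open>\<eta>\<close> makes \<open>L\<close>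
  symmetric, and \<open>\<xi>\<close> has constant length, so \<open>L \<xi> = 0\<close> and \<open>\<eta>\<close> vanishes on the image of \<open>L\<close>.
  Contracting \<open>d\<Phi> = 2 \<alpha> \<eta> \<and> \<Phi>\<close> with \<open>\<xi>\<close> gives

    \<open>nabla\<^sub>\<xi> \<phi> + \<phi> L + L \<phi> = 2 \<alpha> \<phi>\<close>.

  Conjugation by \<open>\<phi>\<close> changes the sign of \<open>nabla\<^sub>\<xi> \<phi>\<close>, because \<open>\<phi>\<^sup>2\<close> is parallel along \<open>\<xi>\<close>, but it
  fixes \<open>\<phi> L + L \<phi>\<close> and \<open>\<phi>\<close>. The equation therefore splits into \<open>nabla\<^sub>\<xi> \<phi> = 0\<close> (\<open>nabla_xi_phi\<close>) and
  \<open>\<phi> L + L \<phi> = 2 \<alpha> \<phi>\<close> (\<open>shape_phi\<close>), and then \<open>h = (\<phi> L - L \<phi>) / 2 = \<phi> L - \<alpha> \<phi>\<close> (\<open>h_eq\<close>).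
  Consequently \<open>h\<close>, \<open>h\<^sup>2\<close> and \<open>nabla\<^sub>\<xi> h = \<phi> (nabla\<^sub>\<xi> L)\<close> are all expressed by \<open>\<phi>\<close> and \<open>L\<close>, and the
  first three identities become algebra, starting from \<open>R(\<xi>,X)\<xi> = (nabla\<^sub>\<xi> L) X + L\<^sup>2 X\<close>.

  The value of \<open>S(\<xi>,\<xi>)\<close> is the trace of the third identity, since conjugation by \<open>\<phi>\<close> preserves the
  trace of an operator that kills \<open>\<xi>\<close>. For \<open>S(X,\<xi>)\<close> one traces
  \<open>R(Y,X)\<xi> = (nabla\<^sub>Y L) X - (nabla\<^sub>X L) Y\<close> over \<open>Y\<close>. By symmetry of \<open>L\<close> the first term contributes
  \<open>g (div L) X\<close>, and the second contributes the derivative of \<open>tr L\<close> along \<open>X\<close>. That derivative is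
  zero: \<open>\<phi> L + L \<phi> = 2 \<alpha> \<phi>\<close> forces \<open>tr L = 2 n \<alpha>\<close> (\<open>trace_shape\<close>). Finally
  \<open>L = \<phi> h + \<alpha> (Id - \<eta> \<otimes> \<xi>)\<close>, and the divergence of \<open>\<eta> \<otimes> \<xi>\<close> is \<open>(tr L) \<xi>\<close>.

  Around this computation stands a layer of foundations. Vector fields are total functions about which
  smoothness is known only on an open set, and the tensors involved are operators on such fields; traces
  and divergences are meaningful only because these operators are local and tensorial. Tensoriality is
  treated once for all operators (\<open>tensorial_at_value\<close>, \<open>tensorial_at_linear\<close>), and the frames in the
  definition of the divergence are produced by a Gram--Schmidt process (\<open>frame_on_finite\<close>).\<close>

section \<open>Calculus of smooth maps\<close>

lemma has_derivative_cong_open: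
  assumes "open S" "x \<in> S" "\<And>y. y \<in> S \<Longrightarrow> f y = g y"
  shows "(f has_derivative D) (at x) \<longleftrightarrow> (g has_derivative D) (at x)"
  using assms has_derivative_transform_within_open[of f D x UNIV S g]
    has_derivative_transform_within_open[of g D x UNIV S f] by auto

lemma frechet_derivative_cong_open:
  assumes "open S" "x \<in> S" "\<And>y. y \<in> S \<Longrightarrow> f y = g y"
  shows "frechet_derivative f (at x) = frechet_derivative g (at x)"
  unfolding frechet_derivative_def using has_derivative_cong_open[OF assms] by simp

lemma Ck_on_cong:
  assumes "open S" "\<And>x. x \<in> S \<Longrightarrow> f x = g x"
  shows "Ck_on k S f \<longleftrightarrow> Ck_on k S g"
  using assms(2)
proof (induction k arbitrary: f g)
  case 0
  then show ?case by (simp cong: continuous_on_cong)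
next
  case (Suc k)
  have "Ck_on k S (\<lambda>x. frechet_derivative f (at x) v) \<longleftrightarrow> Ck_on k S (\<lambda>x. frechet_derivative g (at x) v)" for v
    by (rule Suc.IH) (simp add: frechet_derivative_cong_open[OF assms(1) _ Suc.prems])
  moreover have "f differentiable_on S \<longleftrightarrow> g differentiable_on S"
    using has_derivative_cong_open[OF assms(1), where f = f and g = g] Suc.prems
    unfolding differentiable_on_eq_differentiable_at[OF assms(1)] differentiable_def by blast
  ultimately show ?case by simp
qed

lemma Ck_on_SucI:
  assumes "open S" "\<And>x. x \<in> S \<Longrightarrow> (f has_derivative f' x) (at x)" "\<And>v. Ck_on k S (\<lambda>x. f' x v)"
  shows "Ck_on (Suc k) S f"
proof -
  have "frechet_derivative f (at x) = f' x" if "x \<in> S" for x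
    using assms(2)[OF that] frechet_derivative_at by metis
  then have "Ck_on k S (\<lambda>x. frechet_derivative f (at x) v)" for v
    using Ck_on_cong[OF assms(1), of "\<lambda>x. frechet_derivative f (at x) v" "\<lambda>x. f' x v" k] assms(3) by simp
  moreover have "f differentiable_on S"
    using assms(1,2) by (auto simp: differentiable_on_eq_differentiable_at differentiable_def)
  ultimately show ?thesis by simp
qed

lemma Ck_on_SucD:
  assumes "open S" "Ck_on (Suc k) S f" "x \<in> S"
  shows "(f has_derivative frechet_derivative f (at x)) (at x)"
  using assms by (simp add: differentiable_on_eq_differentiable_at frechet_derivative_works)

lemma Ck_on_lower: "Ck_on (Suc k) S f \<Longrightarrow> Ck_on k S f"
proof (induction k arbitrary: f)
  case 0
  then show ?case by (simp add: differentiable_imp_continuous_on)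
next
  case (Suc k)
  then have "Ck_on k S (\<lambda>x. frechet_derivative f (at x) v)" for v
    by (metis Ck_on.simps(2))
  then show ?case using Suc.prems by simp
qed

lemma Ck_on_const: "open S \<Longrightarrow> Ck_on k S (\<lambda>x. c)"
  by (induction k arbitrary: c) (auto intro!: Ck_on_SucI[where f' = "\<lambda>x v. 0"] simp del: Ck_on.simps(2))

lemma Ck_on_add:
  assumes S: "open S"
  shows "Ck_on k S f \<Longrightarrow> Ck_on k S g \<Longrightarrow> Ck_on k S (\<lambda>x. f x + g x)"
proof (induction k arbitrary: f g)
  case 0
  then show ?case by (simp add: continuous_on_add)
next
  case (Suc k)
  show ?case
    by (rule Ck_on_SucI[OF S has_derivative_add[OF Ck_on_SucD[OF S Suc.prems(1)] Ck_on_SucD[OF S Suc.prems(2)]]])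
       (use Suc in auto)
qed

text \<open>The product rule expresses the derivative of \<open>b (f x) (g x)\<close> by values of \<open>b\<close> again, so the
  induction on the order of differentiability closes.\<close>
lemma Ck_on_bilinear:
  assumes S: "open S" and b: "bounded_bilinear b"
  shows "Ck_on k S f \<Longrightarrow> Ck_on k S g \<Longrightarrow> Ck_on k S (\<lambda>x. b (f x) (g x))"
proof (induction k arbitrary: f g)
  case 0
  then show ?case by (simp add: bounded_bilinear.continuous_on[OF b])
next
  case (Suc k)
  show ?case
  proof (rule Ck_on_SucI[OF S])
    show "((\<lambda>x. b (f x) (g x)) has_derivative
        (\<lambda>v. b (f x) (frechet_derivative g (at x) v) + b (frechet_derivative f (at x) v) (g x))) (at x)"
      if "x \<in> S" for x
      by (rule bounded_bilinear.FDERIV[OF b Ck_on_SucD[OF S Suc.prems(1) that] Ck_on_SucD[OF S Suc.prems(2) that]])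
    show "Ck_on k S (\<lambda>x. b (f x) (frechet_derivative g (at x) v) + b (frechet_derivative f (at x) v) (g x))" for v
      using Suc.prems Ck_on_lower[OF Suc.prems(1)] Ck_on_lower[OF Suc.prems(2)]
      by (intro Ck_on_add[OF S] Suc.IH) auto
  qed
qed

lemma Ck_on_linear:
  assumes S: "open S" and b: "bounded_linear b"
  shows "Ck_on k S f \<Longrightarrow> Ck_on k S (\<lambda>x. b (f x))"
proof (induction k arbitrary: f)
  case 0
  then show ?case by (simp add: bounded_linear.continuous_on[OF b])
next
  case (Suc k)
  show ?case
    by (rule Ck_on_SucI[OF S bounded_linear.has_derivative[OF b Ck_on_SucD[OF S Suc.prems]]])
       (use Suc in auto)
qed

lemma Ck_on_sum:
  assumes "open S" "finite I" "\<And>i. i \<in> I \<Longrightarrow> Ck_on k S (f i)"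
  shows "Ck_on k S (\<lambda>x. \<Sum>i\<in>I. f i x)"
  using assms(2,3) by (induction I rule: finite_induct) (auto intro: Ck_on_const Ck_on_add assms(1))

text \<open>The chain rule contains a derivative of \<open>g\<close> in a direction that varies with the point, which
  \<open>Ck_on\<close> does not control directly. Expanding that direction in the standard basis reduces it to
  derivatives in fixed directions with variable coefficients.\<close>
lemma Ck_on_compose:
  fixes f :: "'a::euclidean_space \<Rightarrow> 'b::euclidean_space" and g :: "'b \<Rightarrow> 'c::real_normed_vector"
  assumes S: "open S" and T: "open T" and ST: "f ` S \<subseteq> T"
  shows "Ck_on k S f \<Longrightarrow> Ck_on k T g \<Longrightarrow> Ck_on k S (\<lambda>x. g (f x))"
proof (induction k arbitrary: g)
  case 0
  then show ?case using ST by (auto intro: continuous_on_compose2)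
next
  case (Suc k)
  let ?g' = "\<lambda>y. frechet_derivative g (at y)" and ?f' = "\<lambda>x. frechet_derivative f (at x)"
  have g: "(g has_derivative ?g' (f x)) (at (f x))" if "x \<in> S" for x
    using Ck_on_SucD[OF T Suc.prems(2)] that ST by blast
  show ?case
  proof (rule Ck_on_SucI[OF S])
    fix x assume x: "x \<in> S"
    have "?g' (f x) (?f' x v) = (\<Sum>b\<in>Basis. (?f' x v \<bullet> b) *\<^sub>R ?g' (f x) b)" for v
    proof -
      have "?g' (f x) (?f' x v) = ?g' (f x) (\<Sum>b\<in>Basis. (?f' x v \<bullet> b) *\<^sub>R b)"
        by (simp only: euclidean_representation)
      also have "\<dots> = (\<Sum>b\<in>Basis. (?f' x v \<bullet> b) *\<^sub>R ?g' (f x) b)"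
        using has_derivative_linear[OF g[OF x]] by (simp add: linear_sum linear_scale)
      finally show ?thesis .
    qed
    then show "((\<lambda>x. g (f x)) has_derivative (\<lambda>v. \<Sum>b\<in>Basis. (?f' x v \<bullet> b) *\<^sub>R ?g' (f x) b)) (at x)"
      using has_derivative_compose[OF Ck_on_SucD[OF S Suc.prems(1) x] g[OF x]] by simp
  next
    fix v
    have "Ck_on k S (\<lambda>x. ?g' (f x) b)" for b
      using Suc.prems(2) by (intro Suc.IH Ck_on_lower[OF Suc.prems(1)]) auto
    moreover have "Ck_on k S (\<lambda>x. ?f' x v \<bullet> b)" for b
      using Suc.prems(1) by (intro Ck_on_linear[OF S bounded_linear_inner_left]) auto
    ultimately show "Ck_on k S (\<lambda>x. \<Sum>b\<in>Basis. (?f' x v \<bullet> b) *\<^sub>R ?g' (f x) b)"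
      by (intro Ck_on_sum S finite_Basis Ck_on_bilinear[OF S bounded_bilinear_scaleR])
  qed
qed

text \<open>The function \<open>r x = 1 / sqrt x\<close> satisfies \<open>r' = - r\<^sup>3 / 2\<close>, a polynomial in \<open>r\<close> itself; this makes
  it the convenient normalising factor for the Gram--Schmidt process.\<close>
lemma Ck_on_inverse_sqrt: "Ck_on k {0<..} (\<lambda>x::real. inverse (sqrt x))"
proof (induction k)
  case 0
  then show ?case by (auto intro!: continuous_intros)
next
  case (Suc k)
  let ?r = "\<lambda>x::real. inverse (sqrt x)"
  show ?case
  proof (rule Ck_on_SucI)
    fix x :: real assume "x \<in> {0<..}"
    then have x: "x > 0" by simp
    have "(?r has_real_derivative - (1/2) * (?r x * (?r x * ?r x))) (at x)"
      by (rule derivative_eq_intros refl | use x in \<open>simp add: divide_simps power2_eq_square\<close>)+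
    then show "(?r has_derivative (\<lambda>v. (- (1/2) * (?r x * (?r x * ?r x))) * v)) (at x)"
      unfolding has_field_derivative_def .
  next
    fix v :: real
    show "Ck_on k {0<..} (\<lambda>x. (- (1/2) * (?r x * (?r x * ?r x))) * v)"
      by (intro Ck_on_bilinear[OF _ bounded_bilinear_mult] Suc Ck_on_const) auto
  qed simp
qed

lemma smooth_on_cong:
  assumes "open S" "\<And>x. x \<in> S \<Longrightarrow> f x = g x"
  shows "smooth_on S f \<longleftrightarrow> smooth_on S g"
  unfolding smooth_on_def using Ck_on_cong[of S f g] assms by blast

lemma smooth_on_const: "open S \<Longrightarrow> smooth_on S (\<lambda>x. c)"
  by (simp add: smooth_on_def Ck_on_const)

lemma smooth_on_add: "open S \<Longrightarrow> smooth_on S f \<Longrightarrow> smooth_on S g \<Longrightarrow> smooth_on S (\<lambda>x. f x + g x)"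
  by (simp add: smooth_on_def Ck_on_add)

lemma smooth_on_bilinear:
  "open S \<Longrightarrow> bounded_bilinear b \<Longrightarrow> smooth_on S f \<Longrightarrow> smooth_on S g \<Longrightarrow> smooth_on S (\<lambda>x. b (f x) (g x))"
  by (simp add: smooth_on_def Ck_on_bilinear)

lemma smooth_on_linear: "open S \<Longrightarrow> bounded_linear b \<Longrightarrow> smooth_on S f \<Longrightarrow> smooth_on S (\<lambda>x. b (f x))"
  by (simp add: smooth_on_def Ck_on_linear)

lemma smooth_on_compose:
  fixes f :: "'a::euclidean_space \<Rightarrow> 'b::euclidean_space" and g :: "'b \<Rightarrow> 'c::real_normed_vector"
  assumes "open S" "open T" "f ` S \<subseteq> T" "smooth_on S f" "smooth_on T g"
  shows "smooth_on S (\<lambda>x. g (f x))"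
  using assms by (simp add: smooth_on_def Ck_on_compose)

lemma smooth_on_has_derivative:
  "open S \<Longrightarrow> smooth_on S f \<Longrightarrow> x \<in> S \<Longrightarrow> (f has_derivative frechet_derivative f (at x)) (at x)"
  unfolding smooth_on_def by (rule Ck_on_SucD) auto

lemma smooth_on_derivative: "smooth_on S f \<Longrightarrow> smooth_on S (\<lambda>x. frechet_derivative f (at x) v)"
  unfolding smooth_on_def using Ck_on.simps(2) by blast

lemma smooth_on_continuous: "smooth_on S f \<Longrightarrow> continuous_on S f"
  unfolding smooth_on_def using Ck_on.simps(1) by blast

lemma Ck_on_subset: "S \<subseteq> T \<Longrightarrow> Ck_on k T f \<Longrightarrow> Ck_on k S f"
  by (induction k arbitrary: f) (auto intro: continuous_on_subset differentiable_on_subset)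

lemma smooth_on_subset: "smooth_on T f \<Longrightarrow> S \<subseteq> T \<Longrightarrow> smooth_on S f"
  by (auto simp: smooth_on_def intro: Ck_on_subset)

section \<open>Smooth fields on a manifold\<close>

locale smooth_manifold =
  fixes A :: "('m::t2_space, 'k::finite) chart set"
  assumes atlas: "smooth_atlas A"
begin

abbreviation pref :: "'m \<Rightarrow> ('m, 'k) chart" where "pref \<equiv> chart_at A"

abbreviation dtrans :: "('m, 'k) chart \<Rightarrow> ('m, 'k) chart \<Rightarrow> 'm \<Rightarrow> real ^ 'k \<Rightarrow> real ^ 'k" where
  "dtrans c d p \<equiv> frechet_derivative (cmap d \<circ> cinv c) (at (cmap c p))"

lemma chart_at: "pref p \<in> A" "p \<in> cdom (pref p)"
proof -
  have "\<exists>c. c \<in> A \<and> p \<in> cdom c"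
    using atlas unfolding smooth_atlas_def by blast
  then have "pref p \<in> A \<and> p \<in> cdom (pref p)"
    unfolding chart_at_def by (rule someI_ex)
  then show "pref p \<in> A" "p \<in> cdom (pref p)" by auto
qed

lemma open_cdom: "c \<in> A \<Longrightarrow> open (cdom c)"
  using atlas unfolding smooth_atlas_def by blast

lemma chart_homeo: "c \<in> A \<Longrightarrow> homeomorphism (cdom c) (cmap c ` cdom c) (cmap c) (cinv c)"
  using atlas unfolding smooth_atlas_def by blast

lemma cinv_cmap: "c \<in> A \<Longrightarrow> p \<in> cdom c \<Longrightarrow> cinv c (cmap c p) = p"
  using chart_homeo by (auto simp: homeomorphism_def)

lemma open_cmap_image:
  assumes "c \<in> A" "open U"
  shows "open (cmap c ` (U \<inter> cdom c))"
proof -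
  have "openin (top_of_set (cdom c)) (U \<inter> cdom c)"
    using assms(2) by (simp add: openin_open Int_commute) blast
  then have "openin (top_of_set (cmap c ` cdom c)) (cmap c ` (U \<inter> cdom c))"
    using homeomorphism_imp_open_map[OF chart_homeo[OF assms(1)]] by blast
  moreover have "open (cmap c ` cdom c)"
    using atlas assms(1) unfolding smooth_atlas_def by blast
  ultimately show ?thesis using openin_open_trans by blast
qed

lemma smooth_transition:
  "c \<in> A \<Longrightarrow> d \<in> A \<Longrightarrow> smooth_on (cmap c ` (cdom c \<inter> cdom d)) (cmap d \<circ> cinv c)"
  using atlas unfolding smooth_atlas_def by blast

lemma transition_has_derivative:
  assumes "c \<in> A" "d \<in> A" "q \<in> cdom c" "q \<in> cdom d"
  shows "(cmap d \<circ> cinv c has_derivative dtrans c d q) (at (cmap c q))"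
proof -
  have "open (cmap c ` (cdom c \<inter> cdom d))"
    using open_cmap_image[OF assms(1) open_cdom[OF assms(2)]] by (simp add: Int_commute)
  then show ?thesis
    using smooth_on_has_derivative[OF _ smooth_transition[OF assms(1,2)]] assms by blast
qed

lemma dtrans_linear:
  "c \<in> A \<Longrightarrow> d \<in> A \<Longrightarrow> q \<in> cdom c \<Longrightarrow> q \<in> cdom d \<Longrightarrow> linear (dtrans c d q)"
  using transition_has_derivative has_derivative_linear by blast

text \<open>The cocycle rule. It converts components between the preferred charts at different points, whose
  choice is arbitrary.\<close>
lemma dtrans_trans:
  assumes "c \<in> A" "d \<in> A" "e \<in> A" "q \<in> cdom c" "q \<in> cdom d" "q \<in> cdom e"
  shows "dtrans d e q (dtrans c d q v) = dtrans c e q v"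
proof -
  have "(cmap d \<circ> cinv c) (cmap c q) = cmap d q"
    using assms by (simp add: cinv_cmap)
  then have "((\<lambda>x. (cmap e \<circ> cinv d) ((cmap d \<circ> cinv c) x)) has_derivative
      (\<lambda>v. dtrans d e q (dtrans c d q v))) (at (cmap c q))"
    using has_derivative_compose[OF transition_has_derivative[OF assms(1,2,4,5)], of "cmap e \<circ> cinv d"]
      transition_has_derivative[OF assms(2,3,5,6)] by metis
  moreover have "open (cmap c ` ((cdom d \<inter> cdom e) \<inter> cdom c))"
    using assms by (intro open_cmap_image open_Int open_cdom)
  ultimately have "(cmap e \<circ> cinv c has_derivative (\<lambda>v. dtrans d e q (dtrans c d q v))) (at (cmap c q))"
    using assms by (elim has_derivative_transform_within_open) (auto simp: cinv_cmap)
  then have "(\<lambda>v. dtrans d e q (dtrans c d q v)) = dtrans c e q"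
    by (rule frechet_derivative_at)
  then show ?thesis by metis
qed

lemma dtrans_refl:
  assumes "c \<in> A" "q \<in> cdom c"
  shows "dtrans c c q v = v"
proof -
  have "open (cmap c ` (UNIV \<inter> cdom c))"
    using assms by (intro open_cmap_image) auto
  then have "(cmap c \<circ> cinv c has_derivative (\<lambda>v. v)) (at (cmap c q))"
    using assms by (intro has_derivative_transform_within_open[OF has_derivative_ident])
      (auto simp: cinv_cmap)
  then have "(\<lambda>v. v) = dtrans c c q"
    by (rule frechet_derivative_at)
  then show ?thesis by metis
qed

lemma rep_cmap: "c \<in> A \<Longrightarrow> q \<in> cdom c \<Longrightarrow> rep A c X (cmap c q) = dtrans (pref q) c q (X q)"
  by (simp add: rep_def comps_def cinv_cmap)

lemma smooth_funD: "smooth_fun A U f \<Longrightarrow> c \<in> A \<Longrightarrow> smooth_on (cmap c ` (U \<inter> cdom c)) (f \<circ> cinv c)"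
  by (simp add: smooth_fun_def)

lemma smooth_vfD: "smooth_vf A U X \<Longrightarrow> c \<in> A \<Longrightarrow> smooth_on (cmap c ` (U \<inter> cdom c)) (rep A c X)"
  by (simp add: smooth_vf_def)

lemma smooth_fun_subset: "smooth_fun A U f \<Longrightarrow> V \<subseteq> U \<Longrightarrow> smooth_fun A V f"
  unfolding smooth_fun_def by (blast intro: smooth_on_subset)

lemma smooth_vf_subset: "smooth_vf A U X \<Longrightarrow> V \<subseteq> U \<Longrightarrow> smooth_vf A V X"
  unfolding smooth_vf_def by (blast intro: smooth_on_subset)

text \<open>Both this lemma and the next say that smoothness may be tested on any coordinate expression that is
  correct over \<open>U\<close>; they avoid rewriting under the inverse of a chart.\<close>
lemma smooth_funI_charts:
  assumes "open U"
    and "\<And>c. c \<in> A \<Longrightarrow> smooth_on (cmap c ` (U \<inter> cdom c)) (F c)"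
    and "\<And>c q. c \<in> A \<Longrightarrow> q \<in> U \<Longrightarrow> q \<in> cdom c \<Longrightarrow> F c (cmap c q) = f q"
  shows "smooth_fun A U f"
  unfolding smooth_fun_def
proof
  fix c assume c: "c \<in> A"
  have "smooth_on (cmap c ` (U \<inter> cdom c)) (F c) \<longleftrightarrow> smooth_on (cmap c ` (U \<inter> cdom c)) (f \<circ> cinv c)"
  proof (intro smooth_on_cong open_cmap_image c assms(1))
    fix y assume "y \<in> cmap c ` (U \<inter> cdom c)"
    then show "F c y = (f \<circ> cinv c) y"
      using assms(3)[OF c] c by (auto simp: cinv_cmap)
  qed
  then show "smooth_on (cmap c ` (U \<inter> cdom c)) (f \<circ> cinv c)"
    using assms(2)[OF c] by simp
qed

lemma smooth_vfI_charts:
  assumes "open U"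
    and "\<And>c. c \<in> A \<Longrightarrow> smooth_on (cmap c ` (U \<inter> cdom c)) (F c)"
    and "\<And>c q. c \<in> A \<Longrightarrow> q \<in> U \<Longrightarrow> q \<in> cdom c \<Longrightarrow> F c (cmap c q) = dtrans (pref q) c q (X q)"
  shows "smooth_vf A U X"
  unfolding smooth_vf_def
proof
  fix c assume c: "c \<in> A"
  have "smooth_on (cmap c ` (U \<inter> cdom c)) (F c) \<longleftrightarrow> smooth_on (cmap c ` (U \<inter> cdom c)) (rep A c X)"
  proof (intro smooth_on_cong open_cmap_image c assms(1))
    fix y assume "y \<in> cmap c ` (U \<inter> cdom c)"
    then show "F c y = (rep A c X) y"
      using assms(3)[OF c] c by (auto simp: rep_cmap)
  qed
  then show "smooth_on (cmap c ` (U \<inter> cdom c)) (rep A c X)"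
    using assms(2)[OF c] by simp
qed

lemma smooth_fun_cong:
  assumes "open U" "smooth_fun A U f" "\<And>q. q \<in> U \<Longrightarrow> g q = f q"
  shows "smooth_fun A U g"
  by (rule smooth_funI_charts[OF assms(1) smooth_funD[OF assms(2)]]) (auto simp: cinv_cmap assms(3))

lemma smooth_vf_cong:
  assumes "open U" "smooth_vf A U X" "\<And>q. q \<in> U \<Longrightarrow> Y q = X q"
  shows "smooth_vf A U Y"
  by (rule smooth_vfI_charts[OF assms(1) smooth_vfD[OF assms(2)]]) (auto simp: rep_cmap assms(3))

lemma smooth_fun_const: "open U \<Longrightarrow> smooth_fun A U (\<lambda>q. c)"
  by (rule smooth_funI_charts[where F = "\<lambda>_ _. c"]) (auto intro: smooth_on_const open_cmap_image)

lemma smooth_fun_add: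
  assumes "open U" "smooth_fun A U f" "smooth_fun A U g"
  shows "smooth_fun A U (\<lambda>q. f q + g q)"
  by (rule smooth_funI_charts[OF assms(1) smooth_on_add[OF open_cmap_image[OF _ assms(1)]
        smooth_funD[OF assms(2)] smooth_funD[OF assms(3)]]])
     (auto simp: cinv_cmap)

lemma smooth_fun_mult:
  assumes "open U" "smooth_fun A U f" "smooth_fun A U g"
  shows "smooth_fun A U (\<lambda>q. f q * g q)"
  by (rule smooth_funI_charts[OF assms(1) smooth_on_bilinear[OF open_cmap_image[OF _ assms(1)]
        bounded_bilinear_mult smooth_funD[OF assms(2)] smooth_funD[OF assms(3)]]])
     (auto simp: cinv_cmap)

lemma smooth_fun_inverse_sqrt:
  assumes "open U" "smooth_fun A U f" "\<And>q. q \<in> U \<Longrightarrow> f q > 0"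
  shows "smooth_fun A U (\<lambda>q. inverse (sqrt (f q)))"
proof (rule smooth_funI_charts[OF assms(1)])
  fix c assume c: "c \<in> A"
  show "smooth_on (cmap c ` (U \<inter> cdom c)) (\<lambda>x. inverse (sqrt ((f \<circ> cinv c) x)))"
    by (rule smooth_on_compose[OF open_cmap_image[OF c assms(1)] open_greaterThan _ smooth_funD[OF assms(2) c]])
       (use Ck_on_inverse_sqrt assms(3) c in \<open>auto simp: smooth_on_def cinv_cmap\<close>)
qed (auto simp: cinv_cmap)

lemma smooth_vf_add:
  assumes "open U" "smooth_vf A U X" "smooth_vf A U Y"
  shows "smooth_vf A U (\<lambda>q. X q + Y q)"
  by (rule smooth_vfI_charts[OF assms(1) smooth_on_add[OF open_cmap_image[OF _ assms(1)]
        smooth_vfD[OF assms(2)] smooth_vfD[OF assms(3)]]])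
     (auto simp: rep_cmap linear_add[OF dtrans_linear] chart_at)

lemma smooth_vf_scale:
  assumes "open U" "smooth_fun A U f" "smooth_vf A U X"
  shows "smooth_vf A U (\<lambda>q. f q *\<^sub>R X q)"
  by (rule smooth_vfI_charts[OF assms(1) smooth_on_bilinear[OF open_cmap_image[OF _ assms(1)]
        bounded_bilinear_scaleR smooth_funD[OF assms(2)] smooth_vfD[OF assms(3)]]])
     (auto simp: rep_cmap cinv_cmap linear_scale[OF dtrans_linear] chart_at)

lemma smooth_vf_zero: "open U \<Longrightarrow> smooth_vf A U (\<lambda>q. 0)"
  by (rule smooth_vfI_charts[where F = "\<lambda>_ _. 0"])
     (auto intro: smooth_on_const open_cmap_image simp: linear_0[OF dtrans_linear] chart_at)

lemma smooth_vf_scale_const: "open U \<Longrightarrow> smooth_vf A U X \<Longrightarrow> smooth_vf A U (\<lambda>q. c *\<^sub>R X q)"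
  by (rule smooth_vf_scale[OF _ smooth_fun_const])

lemma smooth_vf_minus: "open U \<Longrightarrow> smooth_vf A U X \<Longrightarrow> smooth_vf A U (\<lambda>q. - X q)"
  using smooth_vf_scale_const[of U X "- 1"] by simp

lemma smooth_vf_diff:
  "open U \<Longrightarrow> smooth_vf A U X \<Longrightarrow> smooth_vf A U Y \<Longrightarrow> smooth_vf A U (\<lambda>q. X q - Y q)"
  using smooth_vf_add[of U X "\<lambda>q. - Y q"] smooth_vf_minus by simp

lemma smooth_vf_sum:
  assumes "open U" "finite I" "\<And>i. i \<in> I \<Longrightarrow> smooth_vf A U (X i)"
  shows "smooth_vf A U (\<lambda>q. \<Sum>i\<in>I. X i q)"
  using assms(2,3) by (induction I rule: finite_induct) (auto intro: assms(1) smooth_vf_zero smooth_vf_add)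

lemma smooth_fun_sum:
  assumes "open U" "finite I" "\<And>i. i \<in> I \<Longrightarrow> smooth_fun A U (f i)"
  shows "smooth_fun A U (\<lambda>q. \<Sum>i\<in>I. f i q)"
  using assms(2,3) by (induction I rule: finite_induct) (auto intro: assms(1) smooth_fun_const smooth_fun_add)

lemma smooth_fun_continuous_on:
  assumes "open U" "smooth_fun A U f"
  shows "continuous_on U f"
proof -
  have "isCont f p" if p: "p \<in> U" for p
  proof -
    let ?c = "pref p"
    have "continuous_on (cmap ?c ` (U \<inter> cdom ?c)) (f \<circ> cinv ?c)"
      by (rule smooth_on_continuous[OF smooth_funD[OF assms(2) chart_at(1)]])
    moreover have "continuous_on (U \<inter> cdom ?c) (cmap ?c)"
      using chart_homeo[OF chart_at(1)[of p]] by (auto simp: homeomorphism_def intro: continuous_on_subset)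
    ultimately have "continuous_on (U \<inter> cdom ?c) (\<lambda>q. (f \<circ> cinv ?c) (cmap ?c q))"
      by (rule continuous_on_compose2) auto
    then have "continuous_on (U \<inter> cdom ?c) f"
      by (rule continuous_on_eq) (auto simp: cinv_cmap chart_at)
    then show ?thesis
      using p assms(1) chart_at open_cdom by (metis IntI continuous_on_eq_continuous_at open_Int)
  qed
  then show ?thesis by (simp add: continuous_at_imp_continuous_on)
qed

lemma extend_eq: "extend A p v q = dtrans (pref p) (pref q) q v"
  by (simp add: extend_def)

lemma extend_at: "extend A p v p = v"
  by (simp add: extend_eq dtrans_refl chart_at)

text \<open>In a chart \<open>d\<close> the field has as components the differential of the coordinate change from the
  preferred chart \<open>c\<close> at \<open>p\<close>, applied to the constant \<open>v\<close>; this is a derivative of a smooth map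
  composed with the inverse coordinate change.\<close>
lemma smooth_extend: "smooth_vf A (cdom (pref p)) (extend A p v)"
proof -
  let ?c = "pref p"
  note c = chart_at[of p] open_cdom[OF chart_at(1)]
  show ?thesis
  proof (rule smooth_vfI_charts[OF c(3)])
    fix d assume d: "d \<in> A"
    show "smooth_on (cmap d ` (cdom ?c \<inter> cdom d))
        (\<lambda>y. frechet_derivative (cmap d \<circ> cinv ?c) (at ((cmap ?c \<circ> cinv d) y)) v)"
    proof (rule smooth_on_compose[where f = "cmap ?c \<circ> cinv d"])
      show "open (cmap d ` (cdom ?c \<inter> cdom d))" using c d by (intro open_cmap_image)
      show "open (cmap ?c ` (cdom d \<inter> cdom ?c))" using c d by (intro open_cmap_image open_cdom)
      show "smooth_on (cmap d ` (cdom ?c \<inter> cdom d)) (cmap ?c \<circ> cinv d)"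
        using smooth_transition[OF d c(1)] by (simp add: Int_commute)
      show "smooth_on (cmap ?c ` (cdom d \<inter> cdom ?c)) (\<lambda>x. frechet_derivative (cmap d \<circ> cinv ?c) (at x) v)"
        using smooth_on_derivative[OF smooth_transition[OF c(1) d]] by (simp add: Int_commute)
    qed (use d in \<open>auto simp: cinv_cmap\<close>)
  next
    fix d q assume d: "d \<in> A" and q: "q \<in> cdom ?c" "q \<in> cdom d"
    have "(cmap ?c \<circ> cinv d) (cmap d q) = cmap ?c q"
      using d q by (simp add: cinv_cmap)
    moreover have "dtrans (pref q) d q (extend A p v q) = dtrans ?c d q v"
      unfolding extend_eq by (rule dtrans_trans[OF c(1) chart_at(1) d q(1) chart_at(2) q(2)])
    ultimately show "frechet_derivative (cmap d \<circ> cinv ?c) (at ((cmap ?c \<circ> cinv d) (cmap d q))) v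
        = dtrans (pref q) d q (extend A p v q)"
      by (simp only:)
  qed
qed

text \<open>Tangent vectors at \<open>p\<close> are read in the preferred chart at \<open>p\<close>, so at \<open>p\<close> itself the coefficients are the
  entries of \<open>X p\<close>; nearby they are the components of \<open>X\<close> in that one chart, which makes them smooth.\<close>
lemma vf_coordinates:
  assumes "open U" "smooth_vf A U X"
  obtains f :: "'k \<Rightarrow> 'm \<Rightarrow> real" where
    "\<And>i. smooth_fun A (U \<inter> cdom (pref p)) (f i)"
    "\<And>q. q \<in> cdom (pref p) \<Longrightarrow> X q = (\<Sum>i\<in>UNIV. f i q *\<^sub>R extend A p (axis i 1) q)"
    "X p = (\<chi> i. f i p)"
proof -
  let ?c = "pref p"
  let ?f = "\<lambda>i q. rep A ?c X (cmap ?c q) $ i"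
  note c = chart_at[of p] open_cdom[OF chart_at(1)]
  note oI = open_Int[OF assms(1) c(3)]
  show thesis
  proof
    show "smooth_fun A (U \<inter> cdom ?c) (?f i)" for i
    proof (rule smooth_funI_charts[OF oI])
      fix d assume d: "d \<in> A"
      have "smooth_on (cmap d ` (U \<inter> cdom ?c \<inter> cdom d)) (\<lambda>y. rep A ?c X ((cmap ?c \<circ> cinv d) y))"
      proof (rule smooth_on_compose[where f = "cmap ?c \<circ> cinv d", OF open_cmap_image[OF d oI] open_cmap_image[OF c(1) assms(1)]])
        show "smooth_on (cmap d ` (U \<inter> cdom ?c \<inter> cdom d)) (cmap ?c \<circ> cinv d)"
          by (rule smooth_on_subset[OF smooth_transition[OF d c(1)]]) auto
        show "smooth_on (cmap ?c ` (U \<inter> cdom ?c)) (rep A ?c X)"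
          by (rule smooth_vfD[OF assms(2) c(1)])
      qed (use d in \<open>auto simp: cinv_cmap\<close>)
      then show "smooth_on (cmap d ` (U \<inter> cdom ?c \<inter> cdom d)) (\<lambda>y. rep A ?c X ((cmap ?c \<circ> cinv d) y) $ i)"
        by (intro smooth_on_linear[OF open_cmap_image[OF d oI] bounded_linear_vec_nth])
    qed (auto simp: cinv_cmap)
    show "X q = (\<Sum>i\<in>UNIV. ?f i q *\<^sub>R extend A p (axis i 1) q)" if q: "q \<in> cdom ?c" for q
    proof -
      have lin: "linear (dtrans ?c (pref q) q)"
        using q by (intro dtrans_linear) (auto simp: chart_at)
      have "(\<Sum>i\<in>UNIV. ?f i q *\<^sub>R extend A p (axis i 1) q)
          = dtrans ?c (pref q) q (\<Sum>i\<in>UNIV. ?f i q *\<^sub>R axis i 1)"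
        using lin by (simp add: extend_eq linear_sum linear_scale)
      also have "(\<Sum>i\<in>UNIV. ?f i q *\<^sub>R axis i 1) = rep A ?c X (cmap ?c q)"
        by (simp add: basis_expansion flip: scalar_mult_eq_scaleR)
      also have "dtrans ?c (pref q) q \<dots> = X q"
        using q by (simp add: rep_cmap dtrans_trans dtrans_refl chart_at)
      finally show ?thesis by simp
    qed
    show "X p = (\<chi> i. ?f i p)"
      by (simp add: rep_cmap dtrans_refl chart_at)
  qed
qed

lemma smooth_fun_differentiable:
  assumes "open U" "smooth_fun A U f" "p \<in> U"
  shows "(f \<circ> cinv (pref p) has_derivative frechet_derivative (f \<circ> cinv (pref p)) (at (cmap (pref p) p)))
    (at (cmap (pref p) p))"
  using assms chart_at[of p]
  by (intro smooth_on_has_derivative[OF open_cmap_image smooth_funD]) auto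

lemma vf_deriv_eqI:
  assumes "(f \<circ> cinv (pref p) has_derivative D) (at (cmap (pref p) p))"
  shows "vf_deriv A X f p = D (X p)"
  unfolding vf_deriv_def using frechet_derivative_at[OF assms] by simp

lemma vf_deriv_const: "vf_deriv A X (\<lambda>q. c) p = 0"
  by (rule vf_deriv_eqI) (simp add: comp_def)

lemma vf_deriv_add:
  assumes "open U" "smooth_fun A U f" "smooth_fun A U g" "p \<in> U"
  shows "vf_deriv A X (\<lambda>q. f q + g q) p = vf_deriv A X f p + vf_deriv A X g p"
  unfolding vf_deriv_def[of A X f] vf_deriv_def[of A X g]
  by (rule vf_deriv_eqI[where D = "\<lambda>v. frechet_derivative (f \<circ> cinv (pref p)) (at (cmap (pref p) p)) v
       + frechet_derivative (g \<circ> cinv (pref p)) (at (cmap (pref p) p)) v"])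
     (use has_derivative_add[OF smooth_fun_differentiable[OF assms(1,2,4)]
        smooth_fun_differentiable[OF assms(1,3,4)]] in \<open>simp add: comp_def\<close>)

lemma vf_deriv_mult:
  assumes "open U" "smooth_fun A U f" "smooth_fun A U g" "p \<in> U"
  shows "vf_deriv A X (\<lambda>q. f q * g q) p = f p * vf_deriv A X g p + vf_deriv A X f p * g p"
proof -
  have "cinv (pref p) (cmap (pref p) p) = p"
    by (simp add: cinv_cmap chart_at)
  then show ?thesis
    unfolding vf_deriv_def[of A X f] vf_deriv_def[of A X g]
    by (intro vf_deriv_eqI[where D = "\<lambda>v. f p * frechet_derivative (g \<circ> cinv (pref p)) (at (cmap (pref p) p)) v
         + frechet_derivative (f \<circ> cinv (pref p)) (at (cmap (pref p) p)) v * g p"])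
       (use has_derivative_mult[OF smooth_fun_differentiable[OF assms(1,2,4)]
          smooth_fun_differentiable[OF assms(1,3,4)]] in \<open>simp add: comp_def\<close>)
qed

lemma vf_deriv_cong:
  assumes "open U" "p \<in> U" "\<And>q. q \<in> U \<Longrightarrow> f q = g q"
  shows "vf_deriv A X f p = vf_deriv A X g p"
proof -
  let ?c = "pref p"
  have "frechet_derivative (f \<circ> cinv ?c) (at (cmap ?c p)) = frechet_derivative (g \<circ> cinv ?c) (at (cmap ?c p))"
    by (rule frechet_derivative_cong_open[of "cmap ?c ` (U \<inter> cdom ?c)"])
       (use assms chart_at[of p] in \<open>auto simp: cinv_cmap intro!: open_cmap_image\<close>)
  then show ?thesis by (simp add: vf_deriv_def)
qed

lemma vf_deriv_locally_const:
  assumes "open U" "p \<in> U" "\<And>q. q \<in> U \<Longrightarrow> f q = c"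
  shows "vf_deriv A X f p = 0"
  using vf_deriv_cong[OF assms, where X = X] vf_deriv_const by simp

lemma vf_deriv_sum:
  assumes "open U" "p \<in> U" "finite I" "\<And>i. i \<in> I \<Longrightarrow> smooth_fun A U (f i)"
  shows "vf_deriv A X (\<lambda>q. \<Sum>i\<in>I. f i q) p = (\<Sum>i\<in>I. vf_deriv A X (f i) p)"
  using assms(3,4)
proof (induction I rule: finite_induct)
  case empty
  then show ?case by (simp add: vf_deriv_const)
next
  case (insert i I)
  then show ?case
    by (simp add: vf_deriv_add[OF assms(1) _ smooth_fun_sum[OF assms(1)] assms(2)])
qed

end

section \<open>Tensorial operators\<close>

text \<open>Additivity and homogeneity are required only for fields that are smooth near \<open>p\<close>, on neighbourhoods
  of arbitrary size; this is all that the definition of a connection provides.\<close>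
definition tensorial_at :: "('m::topological_space, 'k::finite) chart set \<Rightarrow> 'm
    \<Rightarrow> (('m, 'k) vfield \<Rightarrow> 'v::real_vector) \<Rightarrow> bool" where
  "tensorial_at A p T \<longleftrightarrow>
     (\<forall>U X Y. open U \<longrightarrow> p \<in> U \<longrightarrow> smooth_vf A U X \<longrightarrow> smooth_vf A U Y \<longrightarrow>
        T (\<lambda>q. X q + Y q) = T X + T Y) \<and>
     (\<forall>U f X. open U \<longrightarrow> p \<in> U \<longrightarrow> smooth_fun A U f \<longrightarrow> smooth_vf A U X \<longrightarrow>
        T (\<lambda>q. f q *\<^sub>R X q) = f p *\<^sub>R T X)"

lemma tensorial_at_add:
  assumes "tensorial_at A p T" "open U" "p \<in> U" "smooth_vf A U X" "smooth_vf A U Y"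
  shows "T (\<lambda>q. X q + Y q) = T X + T Y"
  using assms(1)[unfolded tensorial_at_def, THEN conjunct1, rule_format, OF assms(2-5)] .

lemma tensorial_at_scale:
  assumes "tensorial_at A p T" "open U" "p \<in> U" "smooth_fun A U f" "smooth_vf A U X"
  shows "T (\<lambda>q. f q *\<^sub>R X q) = f p *\<^sub>R T X"
  using assms(1)[unfolded tensorial_at_def, THEN conjunct2, rule_format, OF assms(2-5)] .

lemma tensorial_atI:
  assumes "\<And>U X Y. open U \<Longrightarrow> p \<in> U \<Longrightarrow> smooth_vf A U X \<Longrightarrow> smooth_vf A U Y \<Longrightarrow>
      T (\<lambda>q. X q + Y q) = T X + T Y"
    and "\<And>U f X. open U \<Longrightarrow> p \<in> U \<Longrightarrow> smooth_fun A U f \<Longrightarrow> smooth_vf A U X \<Longrightarrow>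
      T (\<lambda>q. f q *\<^sub>R X q) = f p *\<^sub>R T X"
  shows "tensorial_at A p T"
  unfolding tensorial_at_def by (intro conjI allI impI assms)

context smooth_manifold
begin

text \<open>The fields are total functions, so the indicator of \<open>- U\<close> plays the part of a bump function: it is
  smooth on \<open>U\<close>, vanishes at \<open>p\<close>, and multiplication by it does not change a field that vanishes
  on \<open>U\<close>.\<close>
lemma tensorial_at_local:
  fixes T :: "('m, 'k) vfield \<Rightarrow> 'v::real_vector"
  assumes T: "tensorial_at A p T" and U: "open U" "p \<in> U" "smooth_vf A U X"
    and XY: "\<And>q. q \<in> U \<Longrightarrow> X q = Y q"
  shows "T X = T Y"
proof -
  let ?D = "\<lambda>q. Y q - X q" and ?f = "indicator (- U) :: 'm \<Rightarrow> real"
  have D: "smooth_vf A U ?D"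
    by (rule smooth_vf_cong[OF U(1) smooth_vf_zero[OF U(1)]]) (simp add: XY)
  have f: "smooth_fun A U ?f"
    by (rule smooth_fun_cong[OF U(1) smooth_fun_const[OF U(1), of 0]]) simp
  have "?D = (\<lambda>q. ?f q *\<^sub>R ?D q)"
    by (auto simp: indicator_def XY)
  then have "T ?D = T (\<lambda>q. ?f q *\<^sub>R ?D q)" by (rule arg_cong)
  also have "\<dots> = ?f p *\<^sub>R T ?D"
    by (rule tensorial_at_scale[OF T U(1,2) f D])
  finally have D0: "T ?D = 0" using U(2) by simp
  have "T (\<lambda>q. X q + ?D q) = T X + T ?D"
    by (rule tensorial_at_add[OF T U D])
  then show ?thesis using D0 by simp
qed

lemma tensorial_at_sum:
  fixes T :: "('m, 'k) vfield \<Rightarrow> 'v::real_vector"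
  assumes T: "tensorial_at A p T" and U: "open U" "p \<in> U" and "finite I"
    "\<And>i. i \<in> I \<Longrightarrow> smooth_fun A U (f i)" "\<And>i. i \<in> I \<Longrightarrow> smooth_vf A U (X i)"
  shows "T (\<lambda>q. \<Sum>i\<in>I. f i q *\<^sub>R X i q) = (\<Sum>i\<in>I. f i p *\<^sub>R T (X i))"
  using assms(4-)
proof (induction I rule: finite_induct)
  case empty
  have "T (\<lambda>q. 0 *\<^sub>R 0) = 0 *\<^sub>R T (\<lambda>q. 0)"
    by (rule tensorial_at_scale[OF T U smooth_fun_const[OF U(1)] smooth_vf_zero[OF U(1)]])
  then show ?case by simp
next
  case (insert i I)
  have s: "smooth_vf A U (\<lambda>q. f i q *\<^sub>R X i q)" "smooth_vf A U (\<lambda>q. \<Sum>i\<in>I. f i q *\<^sub>R X i q)"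
    using insert by (auto intro!: smooth_vf_sum smooth_vf_scale U)
  have "T (\<lambda>q. f i q *\<^sub>R X i q + (\<Sum>i\<in>I. f i q *\<^sub>R X i q))
      = T (\<lambda>q. f i q *\<^sub>R X i q) + T (\<lambda>q. \<Sum>i\<in>I. f i q *\<^sub>R X i q)"
    by (rule tensorial_at_add[OF T U s])
  moreover have "T (\<lambda>q. f i q *\<^sub>R X i q) = f i p *\<^sub>R T (X i)"
    using insert by (intro tensorial_at_scale[OF T U]) auto
  moreover have "T (\<lambda>q. \<Sum>i\<in>I. f i q *\<^sub>R X i q) = (\<Sum>i\<in>I. f i p *\<^sub>R T (X i))"
    using insert by blast
  ultimately show ?case by (simp only: sum.insert[OF insert.hyps])
qed

lemma tensorial_at_expand:
  fixes T :: "('m, 'k) vfield \<Rightarrow> 'v::real_vector"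
  assumes T: "tensorial_at A p T" and U: "open U" "p \<in> U" "smooth_vf A U X"
  shows "T X = (\<Sum>i\<in>UNIV. X p $ i *\<^sub>R T (extend A p (axis i 1)))"
proof -
  let ?W = "U \<inter> cdom (pref p)"
  obtain f :: "'k \<Rightarrow> 'm \<Rightarrow> real" where f: "\<And>i. smooth_fun A ?W (f i)"
    "\<And>q. q \<in> cdom (pref p) \<Longrightarrow> X q = (\<Sum>i\<in>UNIV. f i q *\<^sub>R extend A p (axis i 1) q)"
    "X p = (\<chi> i. f i p)"
    by (rule vf_coordinates[OF U(1,3), where p = p], rule that)
  have W: "open ?W" "p \<in> ?W" using U by (simp_all add: open_Int open_cdom chart_at)
  have "T X = T (\<lambda>q. \<Sum>i\<in>UNIV. f i q *\<^sub>R extend A p (axis i 1) q)"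
    by (rule tensorial_at_local[OF T W smooth_vf_subset[OF U(3)]]) (auto simp: f(2))
  also have "\<dots> = (\<Sum>i\<in>UNIV. f i p *\<^sub>R T (extend A p (axis i 1)))"
    by (rule tensorial_at_sum[OF T W]) (auto intro: f(1) smooth_vf_subset[OF smooth_extend])
  finally show ?thesis by (simp add: f(3))
qed

lemma tensorial_at_linear:
  fixes T :: "('m, 'k) vfield \<Rightarrow> 'v::real_vector"
  assumes T: "tensorial_at A p T"
  shows "linear (\<lambda>v. T (extend A p v))"
proof -
  have "(\<lambda>v. T (extend A p v)) = (\<lambda>v. \<Sum>i\<in>UNIV. v $ i *\<^sub>R T (extend A p (axis i 1)))"
    by (rule ext) (rule tensorial_at_expand[OF T open_cdom[OF chart_at(1)] chart_at(2) smooth_extend,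
      unfolded extend_at])
  moreover have "linear (\<lambda>v :: real ^ 'k. \<Sum>i\<in>UNIV. v $ i *\<^sub>R T (extend A p (axis i 1)))"
    by (simp add: linear_iff scaleR_add_left sum.distrib scaleR_sum_right)
  ultimately show ?thesis by (simp only:)
qed

text \<open>The value of a tensorial operator depends only on the vector at \<open>p\<close>. In particular the traces
  defined through the fields \<open>extend A p v\<close> can be computed with any local frame.\<close>
lemma tensorial_at_value:
  fixes T :: "('m, 'k) vfield \<Rightarrow> 'v::real_vector"
  assumes T: "tensorial_at A p T" and U: "open U" "p \<in> U" "smooth_vf A U X"
  shows "T X = T (extend A p (X p))"
  using tensorial_at_expand[OF T U]
    tensorial_at_expand[OF T open_cdom[OF chart_at(1)] chart_at(2) smooth_extend, unfolded extend_at]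
  by (rule trans[OF _ sym])

end

section \<open>Pseudo-orthonormal bases\<close>

definition pseudo_orthonormal :: "(real ^ 'k \<Rightarrow> real ^ 'k \<Rightarrow> real) \<Rightarrow> ('k::finite \<Rightarrow> real ^ 'k) \<Rightarrow> bool" where
  "pseudo_orthonormal B e \<longleftrightarrow> (\<forall>i j. i \<noteq> j \<longrightarrow> B (e i) (e j) = 0) \<and>
     (\<forall>i. B (e i) (e i) = 1 \<or> B (e i) (e i) = -1)"

lemma pseudo_orthonormal_sum:
  assumes B: "bilinear B" and e: "pseudo_orthonormal B e" and "finite I"
  shows "B (\<Sum>i\<in>I. c i *\<^sub>R e i) (e j) = (if j \<in> I then c j * B (e j) (e j) else 0)"
proof -
  have lin: "linear (\<lambda>u. B u (e j))" using B by (simp add: bilinear_def)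
  have "B (\<Sum>i\<in>I. c i *\<^sub>R e i) (e j) = (\<Sum>i\<in>I. c i * B (e i) (e j))"
    by (simp add: linear_sum[OF lin] linear_scale[OF lin])
  also have "\<dots> = (\<Sum>i\<in>I. if i = j then c i * B (e i) (e j) else 0)"
    using e by (intro sum.cong) (auto simp: pseudo_orthonormal_def)
  finally show ?thesis using assms(3) by (simp add: sum.delta')
qed

lemma pseudo_orthonormal_square:
  "pseudo_orthonormal B e \<Longrightarrow> B (e i) (e i) * B (e i) (e i) = 1"
  unfolding pseudo_orthonormal_def by (metis mult_1 mult_minus1_right minus_minus)

text \<open>The coefficients of a linear combination are recovered by pairing with the basis vectors, so the
  combination map is injective, and hence surjective because the index set is that of the coordinates.\<close>
lemma pseudo_orthonormal_expansion:
  fixes B :: "real ^ 'k \<Rightarrow> real ^ 'k \<Rightarrow> real" and e :: "'k::finite \<Rightarrow> real ^ 'k"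
  assumes B: "bilinear B" and e: "pseudo_orthonormal B e"
  shows "v = (\<Sum>i\<in>UNIV. (B (e i) (e i) * B v (e i)) *\<^sub>R e i)"
proof -
  let ?L = "\<lambda>c :: real ^ 'k. \<Sum>i\<in>UNIV. c $ i *\<^sub>R e i"
  have coeff: "B (e j) (e j) * B (?L c) (e j) = c $ j" for c j
    using pseudo_orthonormal_sum[OF B e, of UNIV "\<lambda>i. c $ i" j] pseudo_orthonormal_square[OF e, of j]
    by (simp add: ac_simps)
  have "linear ?L"
    by (simp add: linear_iff scaleR_add_left sum.distrib scaleR_sum_right)
  moreover have "inj ?L"
    by (rule injI) (metis coeff vec_eq_iff)
  ultimately have "surj ?L"
    by (rule linear_injective_imp_surjective) simp
  then obtain c where c: "v = ?L c" by (rule surjE)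
  show ?thesis by (simp only: c coeff)
qed

lemma trace_matrix: "trace (matrix f) = (\<Sum>j\<in>UNIV. f (axis j 1) $ j)"
  by (simp add: trace_def matrix_def)

lemma trace_matrix_add: "trace (matrix (\<lambda>v. f v + g v)) = trace (matrix f) + trace (matrix g)"
  by (simp add: trace_matrix sum.distrib)

lemma trace_matrix_scale: "trace (matrix (\<lambda>v. c *\<^sub>R f v)) = c * trace (matrix f)"
  by (simp add: trace_matrix sum_distrib_left)

lemma trace_matrix_compose:
  fixes f g :: "real ^ 'k \<Rightarrow> real ^ 'k"
  assumes "linear f" "linear g"
  shows "trace (matrix (\<lambda>v. f (g v))) = trace (matrix (\<lambda>v. g (f v)))"
  using matrix_compose[OF assms] matrix_compose[OF assms(2,1)] trace_mul_sym
  by (metis comp_def ext)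

lemma trace_matrix_rank_one:
  assumes "linear f"
  shows "trace (matrix (\<lambda>v. f v *\<^sub>R w)) = f w"
proof -
  have "f w = f (\<Sum>j\<in>UNIV. w $ j *\<^sub>R axis j 1)"
    by (simp add: basis_expansion flip: scalar_mult_eq_scaleR)
  also have "\<dots> = (\<Sum>j\<in>UNIV. f (axis j 1) * w $ j)"
    using assms by (simp add: linear_sum linear_scale mult.commute)
  finally show ?thesis by (simp add: trace_matrix)
qed

text \<open>Inserting the expansion of \<open>v\<close> writes \<open>L v\<close> as a sum of operators of rank one, whose traces are
  evaluations.\<close>
lemma trace_pseudo_orthonormal:
  assumes B: "bilinear B" and e: "pseudo_orthonormal B e" and L: "linear L"
  shows "trace (matrix L) = (\<Sum>i\<in>UNIV. B (e i) (e i) * B (L (e i)) (e i))"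
proof -
  have "L = (\<lambda>v. \<Sum>i\<in>UNIV. (B (e i) (e i) * B v (e i)) *\<^sub>R L (e i))"
  proof
    fix v
    have "L v = L (\<Sum>i\<in>UNIV. (B (e i) (e i) * B v (e i)) *\<^sub>R e i)"
      using pseudo_orthonormal_expansion[OF B e] by metis
    then show "L v = (\<Sum>i\<in>UNIV. (B (e i) (e i) * B v (e i)) *\<^sub>R L (e i))"
      by (simp only: linear_sum[OF L] linear_scale[OF L])
  qed
  then have "trace (matrix L) = trace (matrix (\<lambda>v. \<Sum>i\<in>UNIV. (B (e i) (e i) * B v (e i)) *\<^sub>R L (e i)))"
    by (rule arg_cong)
  also have "\<dots> = (\<Sum>j\<in>UNIV. \<Sum>i\<in>UNIV. ((B (e i) (e i) * B (axis j 1) (e i)) *\<^sub>R L (e i)) $ j)"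
    by (simp add: trace_matrix)
  also have "\<dots> = (\<Sum>i\<in>UNIV. trace (matrix (\<lambda>v. (B (e i) (e i) * B v (e i)) *\<^sub>R L (e i))))"
    unfolding trace_matrix by (rule sum.swap)
  also have "\<dots> = (\<Sum>i\<in>UNIV. B (e i) (e i) * B (L (e i)) (e i))"
    using B by (intro sum.cong refl trace_matrix_rank_one)
      (auto simp: bilinear_def linear_iff algebra_simps)
  finally show ?thesis .
qed

section \<open>The Levi-Civita connection\<close>

locale levi_civita_manifold = smooth_manifold A
  for A :: "('m::t2_space, 'k::finite) chart set" +
  fixes g :: "'m \<Rightarrow> real ^ 'k \<Rightarrow> real ^ 'k \<Rightarrow> real" and r s :: nat
    and nabla :: "('m, 'k) vfield \<Rightarrow> ('m, 'k) vfield \<Rightarrow> ('m, 'k) vfield"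
  assumes metric: "pseudo_riemannian A g r s" and connection: "levi_civita A g nabla"
begin

lemma g_bilinear: "bilinear (g p)"
  using metric by (simp add: pseudo_riemannian_def smooth_tensor02_def)

lemma g_sym: "g p u v = g p v u"
  using metric by (simp add: pseudo_riemannian_def)

lemma g_linear: "linear (\<lambda>u. g p u v)" "linear (\<lambda>v. g p u v)"
  using g_bilinear by (auto simp: bilinear_def)

lemmas g_simps = g_linear[THEN linear_add] g_linear[THEN linear_diff] g_linear[THEN linear_neg]
  g_linear[THEN linear_scale] g_linear[THEN linear_0] g_linear[THEN linear_sum]

lemma smooth_g:
  "open U \<Longrightarrow> smooth_vf A U X \<Longrightarrow> smooth_vf A U Y \<Longrightarrow> smooth_fun A U (\<lambda>q. g q (X q) (Y q))"
  using metric by (simp add: pseudo_riemannian_def smooth_tensor02_def)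

lemma ex_pseudo_orthonormal: "\<exists>e. pseudo_orthonormal (g p) e"
  using metric unfolding pseudo_riemannian_def has_signature_def pseudo_orthonormal_def by blast

lemma g_nondegenerate:
  assumes "\<And>v. g p u v = g p w v"
  shows "u = w"
proof -
  obtain e where e: "pseudo_orthonormal (g p) e" using ex_pseudo_orthonormal by blast
  have "u = (\<Sum>i\<in>UNIV. (g p (e i) (e i) * g p u (e i)) *\<^sub>R e i)"
    by (rule pseudo_orthonormal_expansion[OF g_bilinear e])
  also have "\<dots> = (\<Sum>i\<in>UNIV. (g p (e i) (e i) * g p w (e i)) *\<^sub>R e i)"
    by (simp only: assms)
  also have "\<dots> = w"
    by (rule pseudo_orthonormal_expansion[OF g_bilinear e, symmetric])
  finally show ?thesis .
qed

lemma
  assumes "open U" "smooth_vf A U X" "smooth_vf A U Y"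
  shows smooth_nabla: "smooth_vf A U (nabla X Y)"
    and nabla_add_left: "smooth_vf A U Z \<Longrightarrow> p \<in> U \<Longrightarrow>
      nabla (\<lambda>q. X q + Z q) Y p = nabla X Y p + nabla Z Y p"
    and nabla_scale_left: "smooth_fun A U f \<Longrightarrow> p \<in> U \<Longrightarrow>
      nabla (\<lambda>q. f q *\<^sub>R X q) Y p = f p *\<^sub>R nabla X Y p"
    and nabla_add: "smooth_vf A U Z \<Longrightarrow> p \<in> U \<Longrightarrow>
      nabla X (\<lambda>q. Y q + Z q) p = nabla X Y p + nabla X Z p"
    and nabla_scale: "smooth_fun A U f \<Longrightarrow> p \<in> U \<Longrightarrow>
      nabla X (\<lambda>q. f q *\<^sub>R Y q) p = vf_deriv A X f p *\<^sub>R Y p + f p *\<^sub>R nabla X Y p"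
proof -
  have *: "affine_connection A nabla" using connection by (simp add: levi_civita_def)
  show "smooth_vf A U (nabla X Y)"
    using * assms smooth_fun_const[OF assms(1)] unfolding affine_connection_def by blast
  show "nabla (\<lambda>q. X q + Z q) Y p = nabla X Y p + nabla Z Y p" if "smooth_vf A U Z" "p \<in> U"
    using * assms that smooth_fun_const[OF assms(1)] unfolding affine_connection_def by blast
  show "nabla (\<lambda>q. f q *\<^sub>R X q) Y p = f p *\<^sub>R nabla X Y p" if "smooth_fun A U f" "p \<in> U"
    using * assms that unfolding affine_connection_def by blast
  show "nabla X (\<lambda>q. Y q + Z q) p = nabla X Y p + nabla X Z p" if "smooth_vf A U Z" "p \<in> U"
    using * assms that smooth_fun_const[OF assms(1)] unfolding affine_connection_def by blast
  show "nabla X (\<lambda>q. f q *\<^sub>R Y q) p = vf_deriv A X f p *\<^sub>R Y p + f p *\<^sub>R nabla X Y p"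
    if "smooth_fun A U f" "p \<in> U"
    using * assms that unfolding affine_connection_def by blast
qed

lemma lie_bracket_eq:
  assumes "open U" "smooth_vf A U X" "smooth_vf A U Y" "p \<in> U"
  shows "lie_bracket A X Y p = nabla X Y p - nabla Y X p"
  using connection assms unfolding levi_civita_def by metis

lemma vf_deriv_metric:
  assumes "open U" "smooth_vf A U X" "smooth_vf A U Y" "smooth_vf A U Z" "p \<in> U"
  shows "vf_deriv A X (\<lambda>q. g q (Y q) (Z q)) p = g p (nabla X Y p) (Z p) + g p (Y p) (nabla X Z p)"
  using connection assms unfolding levi_civita_def by blast

lemma nabla_scale_const:
  assumes "open U" "smooth_vf A U X" "smooth_vf A U Y" "p \<in> U"
  shows "nabla X (\<lambda>q. c *\<^sub>R Y q) p = c *\<^sub>R nabla X Y p"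
  using nabla_scale[OF assms(1,2,3) smooth_fun_const[OF assms(1)] assms(4)] by (simp add: vf_deriv_const)

lemma nabla_diff:
  assumes "open U" "smooth_vf A U X" "smooth_vf A U Y" "smooth_vf A U Z" "p \<in> U"
  shows "nabla X (\<lambda>q. Y q - Z q) p = nabla X Y p - nabla X Z p"
  using nabla_add[OF assms(1-3) smooth_vf_scale_const[OF assms(1,4)] assms(5), of "-1"]
    nabla_scale_const[OF assms(1,2,4,5), of "-1"] by simp

lemma nabla_zero:
  assumes "open U" "smooth_vf A U X" "p \<in> U"
  shows "nabla X (\<lambda>q. 0) p = 0"
  using nabla_scale_const[OF assms(1,2) smooth_vf_zero[OF assms(1)] assms(3), of 0] by simp

lemma nabla_tensorial:
  assumes U: "open U" "p \<in> U" "smooth_vf A U Y"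
  shows "tensorial_at A p (\<lambda>X. nabla X Y p)"
proof (rule tensorial_atI)
  fix V X Z assume V: "open V" "p \<in> V" "smooth_vf A V X" "smooth_vf A V Z"
  show "nabla (\<lambda>q. X q + Z q) Y p = nabla X Y p + nabla Z Y p"
    using U V by (intro nabla_add_left[of "U \<inter> V"]) (auto intro: smooth_vf_subset)
next
  fix V f X assume V: "open V" "p \<in> V" "smooth_fun A V f" "smooth_vf A V X"
  show "nabla (\<lambda>q. f q *\<^sub>R X q) Y p = f p *\<^sub>R nabla X Y p"
    using U V by (intro nabla_scale_left[of "U \<inter> V"]) (auto intro: smooth_vf_subset smooth_fun_subset)
qed

text \<open>In the second argument a connection is not tensorial, but for a field \<open>D\<close> that vanishes on \<open>U\<close> the
  Leibniz rule with the indicator of \<open>- U\<close> still gives zero: the derivative of the indicator is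
  multiplied by \<open>D p = 0\<close>.\<close>
lemma nabla_local:
  assumes U: "open U" "p \<in> U" "smooth_vf A U X" "smooth_vf A U Y"
    and eq: "\<And>q. q \<in> U \<Longrightarrow> X q = X' q" "\<And>q. q \<in> U \<Longrightarrow> Y q = Y' q"
  shows "nabla X Y p = nabla X' Y' p"
proof -
  let ?D = "\<lambda>q. Y' q - Y q" and ?f = "indicator (- U) :: 'm \<Rightarrow> real"
  have X': "smooth_vf A U X'" and Y': "smooth_vf A U Y'"
    using smooth_vf_cong[OF U(1)] U eq by metis+
  have D: "smooth_vf A U ?D" by (rule smooth_vf_diff[OF U(1) Y' U(4)])
  have f: "smooth_fun A U ?f"
    by (rule smooth_fun_cong[OF U(1) smooth_fun_const[OF U(1), of 0]]) simp
  have "?D = (\<lambda>q. ?f q *\<^sub>R ?D q)"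
    by (auto simp: indicator_def eq)
  then have "nabla X' ?D p = nabla X' (\<lambda>q. ?f q *\<^sub>R ?D q) p" by (rule arg_cong)
  also have "\<dots> = vf_deriv A X' ?f p *\<^sub>R ?D p + ?f p *\<^sub>R nabla X' ?D p"
    by (rule nabla_scale[OF U(1) X' D f U(2)])
  finally have D0: "nabla X' ?D p = 0" using U(2) eq by simp
  have "nabla X' (\<lambda>q. Y q + ?D q) p = nabla X' Y p + nabla X' ?D p"
    by (rule nabla_add[OF U(1) X' U(4) D U(2)])
  then have "nabla X' Y' p = nabla X' Y p" using D0 by simp
  moreover have "nabla X Y p = nabla X' Y p"
    by (rule tensorial_at_local[OF nabla_tensorial[OF U(1,2,4)] U(1-3)]) (rule eq)
  ultimately show ?thesis by simp
qed

lemma nabla_diff_left: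
  assumes "open U" "smooth_vf A U X" "smooth_vf A U Y" "smooth_vf A U Z" "p \<in> U"
  shows "nabla (\<lambda>q. X q - Y q) Z p = nabla X Z p - nabla Y Z p"
  using nabla_add_left[OF assms(1,2,4) smooth_vf_scale_const[OF assms(1,3)] assms(5), of "-1"]
    nabla_scale_left[OF assms(1,3,4) smooth_fun_const[OF assms(1)] assms(5), of "-1"] by simp

text \<open>The torsion-free condition reduces smoothness of the bracket to that of the connection.\<close>
lemma smooth_lie_bracket:
  assumes "open U" "smooth_vf A U X" "smooth_vf A U Y"
  shows "smooth_vf A U (lie_bracket A X Y)"
  by (rule smooth_vf_cong[OF assms(1) smooth_vf_diff[OF assms(1) smooth_nabla smooth_nabla]])
     (use assms lie_bracket_eq in auto)

text \<open>The second covariant derivative, which at \<open>Z = \<xi>\<close> is the covariant derivative of the shape operator: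
  \<open>nabla2 X Y \<xi> = (nabla\<^sub>X L) Y\<close>. Unlike the individual terms of the curvature it is tensorial in both \<open>X\<close>
  and \<open>Y\<close>.\<close>
definition nabla2 :: "('m, 'k) vfield \<Rightarrow> ('m, 'k) vfield \<Rightarrow> ('m, 'k) vfield \<Rightarrow> ('m, 'k) vfield" where
  "nabla2 X Y Z p = nabla X (nabla Y Z) p - nabla (nabla X Y) Z p"

lemma curvature_eq_nabla2:
  assumes U: "open U" "smooth_vf A U X" "smooth_vf A U Y" "smooth_vf A U Z" "p \<in> U"
  shows "curvature A nabla X Y Z p = nabla2 X Y Z p - nabla2 Y X Z p"
proof -
  have "nabla (lie_bracket A X Y) Z p = nabla (\<lambda>q. nabla X Y q - nabla Y X q) Z p"
    by (rule nabla_local[OF U(1,5)]) (use U lie_bracket_eq smooth_lie_bracket in auto)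
  also have "\<dots> = nabla (nabla X Y) Z p - nabla (nabla Y X) Z p"
    by (rule nabla_diff_left[OF U(1) _ _ U(4,5)]) (use U smooth_nabla in auto)
  finally show ?thesis by (simp add: curvature_def nabla2_def)
qed

text \<open>To prove tensoriality of an operator built from fields that are smooth on \<open>U\<close>, it suffices to
  consider neighbourhoods inside \<open>U\<close>.\<close>
lemma tensorial_at_restrict:
  fixes T :: "('m, 'k) vfield \<Rightarrow> 'v::real_vector"
  assumes U: "open U" "p \<in> U"
    and add: "\<And>V X Y. V \<subseteq> U \<Longrightarrow> open V \<Longrightarrow> p \<in> V \<Longrightarrow> smooth_vf A V X \<Longrightarrow> smooth_vf A V Y \<Longrightarrow>
      T (\<lambda>q. X q + Y q) = T X + T Y"
    and scale: "\<And>V f X. V \<subseteq> U \<Longrightarrow> open V \<Longrightarrow> p \<in> V \<Longrightarrow> smooth_fun A V f \<Longrightarrow> smooth_vf A V X \<Longrightarrow>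
      T (\<lambda>q. f q *\<^sub>R X q) = f p *\<^sub>R T X"
  shows "tensorial_at A p T"
proof (rule tensorial_atI)
  fix V X Y assume "open V" "p \<in> V" "smooth_vf A V X" "smooth_vf A V Y"
  then show "T (\<lambda>q. X q + Y q) = T X + T Y"
    using U by (intro add[of "U \<inter> V"]) (auto intro: smooth_vf_subset)
next
  fix V f X assume "open V" "p \<in> V" "smooth_fun A V f" "smooth_vf A V X"
  then show "T (\<lambda>q. f q *\<^sub>R X q) = f p *\<^sub>R T X"
    using U by (intro scale[of "U \<inter> V"]) (auto intro: smooth_vf_subset smooth_fun_subset)
qed

lemma nabla2_tensorial_left:
  assumes U: "open U" "p \<in> U" "smooth_vf A U Y" "smooth_vf A U Z"
  shows "tensorial_at A p (\<lambda>X. nabla2 X Y Z p)"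
proof (rule tensorial_at_restrict[OF U(1,2)])
  fix V X X' assume V: "V \<subseteq> U" "open V" "p \<in> V" "smooth_vf A V X" "smooth_vf A V X'"
  have s: "smooth_vf A V Y" "smooth_vf A V Z" using U V by (auto intro: smooth_vf_subset)
  have n: "smooth_vf A V (nabla X Y)" "smooth_vf A V (nabla X' Y)" "smooth_vf A V (nabla Y Z)"
    using s V by (auto intro: smooth_nabla[OF V(2)])
  have "nabla (nabla (\<lambda>q. X q + X' q) Y) Z p = nabla (\<lambda>q. nabla X Y q + nabla X' Y q) Z p"
    by (rule nabla_local[OF V(2,3) smooth_nabla[OF V(2) smooth_vf_add[OF V(2)]]])
       (use s V nabla_add_left[OF V(2,4) s(1) V(5)] in auto)
  then show "nabla2 (\<lambda>q. X q + X' q) Y Z p = nabla2 X Y Z p + nabla2 X' Y Z p"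
    using nabla_add_left[OF V(2,4) n(3) V(5,3)] nabla_add_left[OF V(2) n(1) s(2) n(2) V(3)]
    by (simp add: nabla2_def algebra_simps)
next
  fix V f X assume V: "V \<subseteq> U" "open V" "p \<in> V" "smooth_fun A V f" "smooth_vf A V X"
  have s: "smooth_vf A V Y" "smooth_vf A V Z" using U V by (auto intro: smooth_vf_subset)
  have n: "smooth_vf A V (nabla X Y)" "smooth_vf A V (nabla Y Z)"
    using s V by (auto intro: smooth_nabla[OF V(2)])
  have "nabla (nabla (\<lambda>q. f q *\<^sub>R X q) Y) Z p = nabla (\<lambda>q. f q *\<^sub>R nabla X Y q) Z p"
    by (rule nabla_local[OF V(2,3) smooth_nabla[OF V(2) smooth_vf_scale[OF V(2)]]])
       (use s V nabla_scale_left[OF V(2,5) s(1) V(4)] in auto)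
  then show "nabla2 (\<lambda>q. f q *\<^sub>R X q) Y Z p = f p *\<^sub>R nabla2 X Y Z p"
    using nabla_scale_left[OF V(2,5) n(2) V(4,3)] nabla_scale_left[OF V(2) n(1) s(2) V(4,3)]
    by (simp add: nabla2_def algebra_simps)
qed

lemma nabla2_tensorial_right:
  assumes U: "open U" "p \<in> U" "smooth_vf A U X" "smooth_vf A U Z"
  shows "tensorial_at A p (\<lambda>Y. nabla2 X Y Z p)"
proof (rule tensorial_at_restrict[OF U(1,2)])
  fix V Y Y' assume V: "V \<subseteq> U" "open V" "p \<in> V" "smooth_vf A V Y" "smooth_vf A V Y'"
  have s: "smooth_vf A V X" "smooth_vf A V Z" using U V by (auto intro: smooth_vf_subset)
  have n: "smooth_vf A V (nabla X Y)" "smooth_vf A V (nabla X Y')"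
    "smooth_vf A V (nabla Y Z)" "smooth_vf A V (nabla Y' Z)"
    using s V by (auto intro: smooth_nabla[OF V(2)])
  have 1: "nabla (nabla X (\<lambda>q. Y q + Y' q)) Z p = nabla (\<lambda>q. nabla X Y q + nabla X Y' q) Z p"
    by (rule nabla_local[OF V(2,3) smooth_nabla[OF V(2) _ smooth_vf_add[OF V(2)]]])
       (use s V nabla_add[OF V(2) s(1) V(4,5)] in auto)
  have 2: "nabla X (nabla (\<lambda>q. Y q + Y' q) Z) p = nabla X (\<lambda>q. nabla Y Z q + nabla Y' Z q) p"
    by (rule nabla_local[OF V(2,3) _ smooth_nabla[OF V(2) smooth_vf_add[OF V(2)]]])
       (use s V nabla_add_left[OF V(2,4) s(2) V(5)] in auto)
  show "nabla2 X (\<lambda>q. Y q + Y' q) Z p = nabla2 X Y Z p + nabla2 X Y' Z p"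
    using 1 2 nabla_add_left[OF V(2) n(1) s(2) n(2) V(3)] nabla_add[OF V(2) s(1) n(3,4) V(3)]
    by (simp add: nabla2_def algebra_simps)
next
  fix V f Y assume V: "V \<subseteq> U" "open V" "p \<in> V" "smooth_fun A V f" "smooth_vf A V Y"
  let ?d = "vf_deriv A X f p"
  have s: "smooth_vf A V X" "smooth_vf A V Z" using U V by (auto intro: smooth_vf_subset)
  have n: "smooth_vf A V (nabla X Y)" "smooth_vf A V (nabla Y Z)"
    using s V by (auto intro: smooth_nabla[OF V(2)])
  have 1: "nabla X (nabla (\<lambda>q. f q *\<^sub>R Y q) Z) p = nabla X (\<lambda>q. f q *\<^sub>R nabla Y Z q) p"
    by (rule nabla_local[OF V(2,3) _ smooth_nabla[OF V(2) smooth_vf_scale[OF V(2)]]])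
       (use s V nabla_scale_left[OF V(2,5) s(2) V(4)] in auto)
  have sf: "smooth_vf A V (\<lambda>q. f q *\<^sub>R Y q)" using V by (intro smooth_vf_scale)
  have sd: "smooth_vf A V (\<lambda>q. f q *\<^sub>R nabla X Y q)" "smooth_vf A V (\<lambda>q. ?d *\<^sub>R Y q)"
    using V n by (auto intro: smooth_vf_scale smooth_vf_scale_const)
  note ten = tensorial_at_value[OF nabla_tensorial[OF V(2,3) s(2)] V(2,3)]
  \<comment> \<open>By tensoriality in the first slot only the value at \<open>p\<close> matters, so the derivative of \<open>f\<close>
    may be frozen to the constant \<open>?d\<close>, which keeps the field smooth.\<close>
  have "nabla (nabla X (\<lambda>q. f q *\<^sub>R Y q)) Z p
      = nabla (\<lambda>q. f q *\<^sub>R nabla X Y q + ?d *\<^sub>R Y q) Z p"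
    using ten[OF smooth_nabla[OF V(2) s(1) sf]] ten[OF smooth_vf_add[OF V(2) sd]]
      nabla_scale[OF V(2) s(1) V(5,4,3)] by (simp add: add.commute)
  also have "\<dots> = f p *\<^sub>R nabla (nabla X Y) Z p + ?d *\<^sub>R nabla Y Z p"
    using nabla_add_left[OF V(2) sd(1) s(2) sd(2) V(3)] nabla_scale_left[OF V(2) n(1) s(2) V(4,3)]
      nabla_scale_left[OF V(2,5) s(2) smooth_fun_const[OF V(2)] V(3)]
    by simp
  finally show "nabla2 X (\<lambda>q. f q *\<^sub>R Y q) Z p = f p *\<^sub>R nabla2 X Y Z p"
    using 1 nabla_scale[OF V(2) s(1) n(2) V(4,3)] by (simp add: nabla2_def algebra_simps)
qed

lemma curvature_tensorial:
  assumes U: "open U" "p \<in> U" "smooth_vf A U Y" "smooth_vf A U Z"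
  shows "tensorial_at A p (\<lambda>X. curvature A nabla X Y Z p)"
proof (rule tensorial_at_restrict[OF U(1,2)])
  fix V X X' assume V: "V \<subseteq> U" "open V" "p \<in> V" "smooth_vf A V X" "smooth_vf A V X'"
  have s: "smooth_vf A V Y" "smooth_vf A V Z" using U V by (auto intro: smooth_vf_subset)
  show "curvature A nabla (\<lambda>q. X q + X' q) Y Z p = curvature A nabla X Y Z p + curvature A nabla X' Y Z p"
    using V(3) curvature_eq_nabla2[OF V(2) _ s] V smooth_vf_add[OF V(2,4,5)]
      tensorial_at_add[OF nabla2_tensorial_left[OF V(2,3) s] V(2-5)]
      tensorial_at_add[OF nabla2_tensorial_right[OF V(2,3) s] V(2-5)]
    by simp
next
  fix V f X assume V: "V \<subseteq> U" "open V" "p \<in> V" "smooth_fun A V f" "smooth_vf A V X"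
  have s: "smooth_vf A V Y" "smooth_vf A V Z" using U V by (auto intro: smooth_vf_subset)
  show "curvature A nabla (\<lambda>q. f q *\<^sub>R X q) Y Z p = f p *\<^sub>R curvature A nabla X Y Z p"
    using V(3) curvature_eq_nabla2[OF V(2) _ s] V smooth_vf_scale[OF V(2,4,5)]
      tensorial_at_scale[OF nabla2_tensorial_left[OF V(2,3) s] V(2-5)]
      tensorial_at_scale[OF nabla2_tensorial_right[OF V(2,3) s] V(2-5)]
    by (simp add: scaleR_diff_right)
qed

section \<open>Pseudo-orthonormal frames\<close>

text \<open>Gram--Schmidt, extending a pseudo-orthonormal basis at \<open>p\<close> to a neighbourhood. In indefinite signature
  the process may break down on null vectors; here the vector \<open>W\<close> to be normalised equals \<open>e j\<close> at
  \<open>p\<close>, so \<open>g W W\<close> keeps its sign nearby, and the neighbourhood is shrunk accordingly.\<close>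
lemma frame_on_finite:
  assumes e: "pseudo_orthonormal (g p) e" and "finite I"
  shows "\<exists>U E. open U \<and> p \<in> U \<and> (\<forall>i\<in>I. smooth_vf A U (E i) \<and> E i p = e i) \<and>
    (\<forall>q\<in>U. \<forall>i\<in>I. \<forall>j\<in>I. g q (E i q) (E j q) = g p (e i) (e j))"
  using assms(2)
proof (induction I rule: finite_induct)
  case empty
  then show ?case by (intro exI[of _ UNIV]) auto
next
  case (insert j I)
  then obtain U E where U: "open U" "p \<in> U"
    and E: "\<And>i. i \<in> I \<Longrightarrow> smooth_vf A U (E i)" "\<And>i. i \<in> I \<Longrightarrow> E i p = e i"
    and gE: "\<And>q i l. q \<in> U \<Longrightarrow> i \<in> I \<Longrightarrow> l \<in> I \<Longrightarrow> g q (E i q) (E l q) = g p (e i) (e l)"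
    by metis
  define U0 where "U0 = U \<inter> cdom (pref p)"
  define V where "V = extend A p (e j)"
  define \<epsilon> where "\<epsilon> i = g p (e i) (e i)" for i
  define W where "W q = V q - (\<Sum>i\<in>I. (\<epsilon> i * g q (V q) (E i q)) *\<^sub>R E i q)" for q
  define f where "f q = \<epsilon> j * g q (W q) (W q)" for q
  define U' where "U' = f -` {0<..} \<inter> U0"
  define Ej where "Ej q = inverse (sqrt (f q)) *\<^sub>R W q" for q
  have orth: "g p (e i) (e l) = 0" if "i \<noteq> l" for i l
    using e that by (simp add: pseudo_orthonormal_def)
  have \<epsilon>2: "\<epsilon> i * \<epsilon> i = 1" for i
    using pseudo_orthonormal_square[OF e] by (simp add: \<epsilon>_def)
  have U0: "open U0" "p \<in> U0" "U0 \<subseteq> U"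
    using U by (simp_all add: U0_def open_Int open_cdom chart_at)
  have sE: "smooth_vf A U0 (E i)" if "i \<in> I" for i
    using smooth_vf_subset[OF E(1)[OF that] U0(3)] .
  have sV: "smooth_vf A U0 V"
    unfolding V_def by (rule smooth_vf_subset[OF smooth_extend]) (simp add: U0_def)
  have sW: "smooth_vf A U0 W"
    unfolding W_def[abs_def] using insert.hyps U0 sV sE
    by (intro smooth_vf_diff smooth_vf_sum smooth_vf_scale smooth_fun_mult smooth_g smooth_fun_const) auto
  have sf: "smooth_fun A U0 f"
    unfolding f_def[abs_def] using U0 sW by (intro smooth_fun_mult smooth_g smooth_fun_const)
  have Wp: "W p = e j"
  proof -
    have "g p (V p) (E i p) = 0" if "i \<in> I" for i
    proof -
      have "j \<noteq> i" using insert.hyps(2) that by blast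
      then show ?thesis using orth E(2)[OF that] by (simp add: V_def extend_at)
    qed
    then show ?thesis by (simp add: W_def V_def extend_at)
  qed
  have "open (f -` {0<..} \<inter> U0)"
    using smooth_fun_continuous_on[OF U0(1) sf] continuous_on_open_vimage[OF U0(1)] open_greaterThan by blast
  then have U': "open U'" "p \<in> U'" "U' \<subseteq> U0"
    using U0 \<epsilon>2[of j] by (auto simp: U'_def f_def Wp \<epsilon>_def)
  have WE: "g q (W q) (E i q) = 0" if "q \<in> U'" "i \<in> I" for q i
  proof -
    have q: "q \<in> U" using that U' U0 by auto
    have "(\<Sum>l\<in>I. \<epsilon> l * g q (V q) (E l q) * g q (E l q) (E i q))
        = (\<Sum>l\<in>I. if l = i then \<epsilon> i * g q (V q) (E i q) * \<epsilon> i else 0)"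
      using gE[OF q _ that(2)] orth by (intro sum.cong) (auto simp: \<epsilon>_def)
    also have "\<dots> = g q (V q) (E i q)"
      using insert.hyps that \<epsilon>2[of i] by (simp add: sum.delta)
    finally show ?thesis
      by (simp add: W_def g_simps)
  qed
  have "smooth_vf A U' (\<lambda>q. inverse (sqrt (f q)) *\<^sub>R W q)"
    using U' sf sW by (intro smooth_vf_scale smooth_fun_inverse_sqrt)
      (auto intro: smooth_vf_subset smooth_fun_subset simp: U'_def)
  then have sEj: "smooth_vf A U' Ej" by (simp add: Ej_def[abs_def])
  have Ejp: "Ej p = e j"
    using \<epsilon>2[of j] by (simp add: Ej_def f_def Wp \<epsilon>_def)
  have EjEj: "g q (Ej q) (Ej q) = \<epsilon> j" if "q \<in> U'" for q
  proof -
    have f: "f q > 0" using that by (simp add: U'_def)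
    have "g q (W q) (W q) = \<epsilon> j * f q"
      using \<epsilon>2[of j] by (simp add: f_def flip: mult.assoc)
    then have "g q (Ej q) (Ej q) = (inverse (sqrt (f q)) * inverse (sqrt (f q)) * f q) * \<epsilon> j"
      by (simp add: Ej_def g_simps)
    also have "inverse (sqrt (f q)) * inverse (sqrt (f q)) * f q = 1"
      using f by (simp add: field_simps)
    finally show ?thesis by simp
  qed
  have "smooth_vf A U' (E i)" if "i \<in> I" for i
    using sE[OF that] smooth_vf_subset U'(3) by blast
  then have "\<forall>i\<in>insert j I. smooth_vf A U' ((E(j := Ej)) i) \<and> (E(j := Ej)) i p = e i"
    using sEj Ejp E(2) by auto
  moreover have "\<forall>q\<in>U'. \<forall>i\<in>insert j I. \<forall>l\<in>insert j I.
      g q ((E(j := Ej)) i q) ((E(j := Ej)) l q) = g p (e i) (e l)"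
  proof (intro ballI)
    fix q i l assume q: "q \<in> U'" and il: "i \<in> insert j I" "l \<in> insert j I"
    have "g q (Ej q) (E i q) = 0" "g q (E i q) (Ej q) = 0" if "i \<in> I" for i
      using WE[OF q that] g_sym[of q "E i q"] by (auto simp: Ej_def g_simps)
    moreover have "g q (E i q) (E l q) = g p (e i) (e l)" if "i \<in> I" "l \<in> I" for i l
      using gE that q U' U0 by blast
    ultimately show "g q ((E(j := Ej)) i q) ((E(j := Ej)) l q) = g p (e i) (e l)"
      using EjEj[OF q] il insert.hyps orth by (auto simp: \<epsilon>_def)
  qed
  ultimately show ?case using U' by blast
qed

lemma ex_frame: "\<exists>E U. p \<in> U \<and> pseudo_orthonormal_frame A g U E"
proof -
  obtain e where e: "pseudo_orthonormal (g p) e" using ex_pseudo_orthonormal by blast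
  from frame_on_finite[OF e finite] obtain U E where "open U" "p \<in> U" "\<And>i. smooth_vf A U (E i)"
    "\<And>q i j. q \<in> U \<Longrightarrow> g q (E i q) (E j q) = g p (e i) (e j)"
    by (metis UNIV_I)
  then show ?thesis using e
    by (intro exI[of _ E] exI[of _ U]) (auto simp: pseudo_orthonormal_frame_def pseudo_orthonormal_def)
qed

lemma divergence_frame:
  obtains U E where "p \<in> U" "open U" "\<And>i. smooth_vf A U (E i)"
    "\<And>q. q \<in> U \<Longrightarrow> pseudo_orthonormal (g q) (\<lambda>i. E i q)"
    "\<And>F. divergence11 A g nabla F p = (\<Sum>i\<in>UNIV. g p (E i p) (E i p) *\<^sub>R cov_deriv11 nabla (E i) F (E i) p)"
proof -
  define E where "E = (SOME E. \<exists>U. p \<in> U \<and> pseudo_orthonormal_frame A g U E)"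
  have "\<exists>U. p \<in> U \<and> pseudo_orthonormal_frame A g U E"
    unfolding E_def by (rule someI_ex[OF ex_frame])
  then obtain U where "p \<in> U" "pseudo_orthonormal_frame A g U E" by blast
  then show thesis
    by (intro that[of U E]) (auto simp: pseudo_orthonormal_frame_def pseudo_orthonormal_def
        divergence11_def Let_def E_def)
qed

end

lemma act_apply [simp]: "act T X p = T p (X p)"
  by (simp add: act_def)

section \<open>Almost para-Kenmotsu manifolds\<close>

locale para_Kenmotsu_manifold = levi_civita_manifold A g "n + 1" n nabla
  for A :: "('m::t2_space, 'k::finite) chart set" and g n nabla +
  fixes \<phi> :: "'m \<Rightarrow> real ^ 'k \<Rightarrow> real ^ 'k" and \<xi> :: "('m, 'k) vfield"
    and \<eta> :: "'m \<Rightarrow> real ^ 'k \<Rightarrow> real" and \<alpha> :: real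
  assumes kenmotsu: "almost_para_Kenmotsu A n \<alpha> \<phi> \<xi> \<eta> g"
begin

lemma paracontact: "almost_paracontact_metric A n \<phi> \<xi> \<eta> g"
  using kenmotsu by (simp add: almost_para_Kenmotsu_def)

lemma phi_linear: "linear (\<phi> p)"
  using paracontact by (simp add: almost_paracontact_metric_def smooth_tensor11_def)

lemma eta_linear: "linear (\<eta> p)"
  using paracontact by (simp add: almost_paracontact_metric_def smooth_form1_def)

lemmas phi_simps = phi_linear[THEN linear_add] phi_linear[THEN linear_diff] phi_linear[THEN linear_neg]
  phi_linear[THEN linear_scale] phi_linear[THEN linear_0]

lemmas eta_simps = eta_linear[THEN linear_add] eta_linear[THEN linear_diff] eta_linear[THEN linear_neg]
  eta_linear[THEN linear_scale] eta_linear[THEN linear_0]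

lemma smooth_phi: "open U \<Longrightarrow> smooth_vf A U X \<Longrightarrow> smooth_vf A U (act \<phi> X)"
  using paracontact by (simp add: almost_paracontact_metric_def smooth_tensor11_def)

lemma smooth_xi: "smooth_vf A U \<xi>"
proof -
  have "smooth_vf A UNIV \<xi>" using paracontact by (simp add: almost_paracontact_metric_def)
  then show ?thesis by (rule smooth_vf_subset) simp
qed

lemma smooth_eta: "open U \<Longrightarrow> smooth_vf A U X \<Longrightarrow> smooth_fun A U (\<lambda>q. \<eta> q (X q))"
  using paracontact by (simp add: almost_paracontact_metric_def smooth_form1_def)

lemma eta_xi: "\<eta> p (\<xi> p) = 1"
  and phi_phi: "\<phi> p (\<phi> p v) = v - \<eta> p v *\<^sub>R \<xi> p"
  and g_phi_phi: "g p (\<phi> p u) (\<phi> p v) = - g p u v + \<eta> p u * \<eta> p v"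
  and card: "CARD('k) = 2 * n + 1"
  using paracontact by (auto simp: almost_paracontact_metric_def)

lemma xi_nonzero: "\<xi> p \<noteq> 0"
  using eta_xi[of p] linear_0[OF eta_linear] by force

text \<open>The two ways to bracket \<open>\<phi>\<^sup>3\<close>. The relations \<open>\<phi> \<xi> = 0\<close> and \<open>\<eta> \<circ> \<phi> = 0\<close> follow from it.\<close>
lemma phi_cubed: "\<eta> p (\<phi> p v) *\<^sub>R \<xi> p = \<eta> p v *\<^sub>R \<phi> p (\<xi> p)"
proof -
  have "\<phi> p (\<phi> p (\<phi> p v)) = \<phi> p (v - \<eta> p v *\<^sub>R \<xi> p)" by (simp only: phi_phi)
  then show ?thesis by (simp add: phi_phi[of p "\<phi> p v"] phi_simps)
qed

lemma phi_xi: "\<phi> p (\<xi> p) = 0"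
proof -
  let ?c = "\<eta> p (\<phi> p (\<xi> p))"
  have "\<phi> p (\<xi> p) = ?c *\<^sub>R \<xi> p" using phi_cubed[of p "\<xi> p"] by (simp add: eta_xi)
  then have "\<phi> p (\<phi> p (\<xi> p)) = ?c *\<^sub>R ?c *\<^sub>R \<xi> p"
    using linear_scale[OF phi_linear] by metis
  then have "?c = 0" using xi_nonzero by (simp add: phi_phi eta_xi)
  then show ?thesis using \<open>\<phi> p (\<xi> p) = ?c *\<^sub>R \<xi> p\<close> by simp
qed

lemma eta_phi: "\<eta> p (\<phi> p v) = 0"
  using phi_cubed[of p v] xi_nonzero by (simp add: phi_xi)

lemma eta_g: "\<eta> p v = g p v (\<xi> p)"
  using g_phi_phi[of p v "\<xi> p"] by (simp add: phi_xi eta_xi g_simps)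

lemma g_phi_skew: "g p (\<phi> p u) v = - g p u (\<phi> p v)"
  using g_phi_phi[of p u "\<phi> p v"] by (simp add: phi_phi g_simps eta_phi flip: eta_g)

lemma g_xi_xi: "g p (\<xi> p) (\<xi> p) = 1"
  using eta_xi by (simp add: eta_g)

lemmas smooth_intros = smooth_vf_add smooth_vf_diff smooth_vf_scale smooth_vf_scale_const
  smooth_nabla smooth_phi smooth_xi smooth_g smooth_eta smooth_fun_mult smooth_fun_const

section \<open>The shape operator of the characteristic vector field\<close>

text \<open>This is \<open>d\<eta> = 0\<close> written with the metric: in \<open>d\<eta>(X,Y)\<close> the derivatives of \<open>X\<close> and \<open>Y\<close> cancel against
  the bracket because the connection is torsion-free.\<close>
lemma shape_symmetric:
  assumes U: "open U" "p \<in> U" "smooth_vf A U X" "smooth_vf A U Y"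
  shows "g p (nabla X \<xi> p) (Y p) = g p (nabla Y \<xi> p) (X p)"
proof -
  have "d_form1 A \<eta> X Y p = 0"
    using kenmotsu U unfolding almost_para_Kenmotsu_def by blast
  then show ?thesis
    using vf_deriv_metric[OF U(1,3,4) smooth_xi U(2)] vf_deriv_metric[OF U(1,4,3) smooth_xi U(2)]
      g_sym[of p "Y p"] g_sym[of p "X p"]
    by (simp add: d_form1_def eta_g lie_bracket_eq[OF U(1,3,4,2)] g_simps)
qed

lemma eta_shape:
  assumes U: "open U" "p \<in> U" "smooth_vf A U X"
  shows "\<eta> p (nabla X \<xi> p) = 0"
  using vf_deriv_metric[OF U(1,3) smooth_xi smooth_xi U(2)] g_sym[of p "\<xi> p"]
  by (simp add: g_xi_xi vf_deriv_const eta_g)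

text \<open>Symmetry moves \<open>\<xi>\<close> to the other side: \<open>g (L \<xi>) v = g (L v) \<xi>\<close>, and this is half the derivative of
  \<open>g \<xi> \<xi> = 1\<close>.\<close>
lemma nabla_xi_xi: "nabla \<xi> \<xi> = (\<lambda>p. 0)"
proof
  fix p
  show "nabla \<xi> \<xi> p = 0"
  proof (rule g_nondegenerate)
    fix v
    note V = open_cdom[OF chart_at(1)[of p]] chart_at(2)[of p] smooth_extend[of p v]
    show "g p (nabla \<xi> \<xi> p) v = g p 0 v"
      using shape_symmetric[OF V(1,2) smooth_xi V(3)] eta_shape[OF V]
      by (simp add: extend_at eta_g g_simps)
  qed
qed

lemma deriv_eta:
  assumes U: "open U" "p \<in> U" "smooth_vf A U X" "smooth_vf A U Y"
  shows "vf_deriv A X (\<lambda>q. \<eta> q (Y q)) p = \<eta> p (nabla X Y p) + g p (nabla X \<xi> p) (Y p)"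
  using vf_deriv_metric[OF U(1,3,4) smooth_xi U(2)] g_sym[of p "Y p"] by (simp add: eta_g)

lemma deriv_eta_xi:
  assumes U: "open U" "p \<in> U" "smooth_vf A U Y"
  shows "vf_deriv A \<xi> (\<lambda>q. \<eta> q (Y q)) p = \<eta> p (nabla \<xi> Y p)"
  using deriv_eta[OF U(1,2) smooth_xi U(3)] by (simp add: nabla_xi_xi g_simps)

lemma eta_nabla_xi:
  assumes U: "open U" "p \<in> U" "smooth_vf A U Y" and "\<And>q. q \<in> U \<Longrightarrow> \<eta> q (Y q) = 0"
  shows "\<eta> p (nabla \<xi> Y p) = 0"
  using deriv_eta_xi[OF U] vf_deriv_locally_const[OF U(1,2) assms(4)] by simp

text \<open>The equation \<open>d\<Phi> = 2 \<alpha> \<eta> \<and> \<Phi>\<close> evaluated on \<open>\<xi>\<close>, \<open>Y\<close> and an arbitrary \<open>Z\<close>. As \<open>\<xi>\<close> lies in the kernel of \<open>\<Phi>\<close>,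
  only a Lie derivative of \<open>\<Phi>\<close> along \<open>\<xi>\<close> remains, and symmetry of the shape operator brings it into the
  form \<open>(nabla\<^sub>\<xi> \<phi> + \<phi> L + L \<phi>) Y = 2 \<alpha> \<phi> Y\<close>.\<close>
lemma d_fundamental_xi:
  assumes U: "open U" "p \<in> U" "smooth_vf A U Y"
  shows "nabla \<xi> (act \<phi> Y) p - \<phi> p (nabla \<xi> Y p) + \<phi> p (nabla Y \<xi> p) + nabla (act \<phi> Y) \<xi> p
    = (2 * \<alpha>) *\<^sub>R \<phi> p (Y p)"
proof (rule g_nondegenerate)
  fix z
  define V where "V = U \<inter> cdom (pref p)"
  define Z where "Z = extend A p z"
  have V: "open V" "p \<in> V" "V \<subseteq> U"
    using U by (simp_all add: V_def open_Int open_cdom chart_at)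
  have Y: "smooth_vf A V Y" using smooth_vf_subset[OF U(3) V(3)] .
  have Z: "smooth_vf A V Z" unfolding Z_def by (rule smooth_vf_subset[OF smooth_extend]) (simp add: V_def)
  have [simp]: "Z p = z" by (simp add: Z_def extend_at)
  have fY: "smooth_vf A V (act \<phi> Y)" by (intro smooth_intros V Y)
  let ?\<Phi> = "fundamental_form \<phi> g"
  have \<Phi>0: "?\<Phi> q (\<xi> q) v = 0" "?\<Phi> q v (\<xi> q) = 0" for q v
    by (simp_all add: fundamental_form_def phi_xi g_simps eta_phi flip: eta_g)
  have "d_form2 A ?\<Phi> \<xi> Y Z p = 2 * \<alpha> * wedge12 \<eta> ?\<Phi> \<xi> Y Z p"
    by (rule kenmotsu[unfolded almost_para_Kenmotsu_def, THEN conjunct2, THEN conjunct2, rule_format,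
          OF V(1) smooth_xi Y Z V(2)])
  then have "vf_deriv A \<xi> (\<lambda>q. g q (act \<phi> Y q) (Z q)) p - g p (\<phi> p (lie_bracket A \<xi> Y p)) z
      - g p (\<phi> p (lie_bracket A Z \<xi> p)) (Y p) = 2 * \<alpha> * g p (\<phi> p (Y p)) z"
    by (simp add: d_form2_def wedge12_def \<Phi>0 vf_deriv_const eta_xi)
       (simp add: fundamental_form_def)
  moreover have "g p (\<phi> p (nabla Z \<xi> p)) (Y p) = - g p (nabla (act \<phi> Y) \<xi> p) z"
    using shape_symmetric[OF V(1,2) Z fY] by (simp add: g_phi_skew)
  moreover have "g p (\<phi> p (nabla \<xi> Z p)) (Y p) = - g p (\<phi> p (Y p)) (nabla \<xi> Z p)"
    using g_phi_skew g_sym by metis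
  ultimately show "g p (nabla \<xi> (act \<phi> Y) p - \<phi> p (nabla \<xi> Y p) + \<phi> p (nabla Y \<xi> p) + nabla (act \<phi> Y) \<xi> p) z
      = g p ((2 * \<alpha>) *\<^sub>R \<phi> p (Y p)) z"
    using vf_deriv_metric[OF V(1) smooth_xi fY Z V(2)]
    by (simp add: lie_bracket_eq[OF V(1) smooth_xi Y V(2)] lie_bracket_eq[OF V(1) Z smooth_xi V(2)]
        g_simps phi_simps)
qed

lemma nabla_xi_phi_phi:
  assumes U: "open U" "p \<in> U" "smooth_vf A U Y"
  shows "nabla \<xi> (act \<phi> (act \<phi> Y)) p = \<phi> p (\<phi> p (nabla \<xi> Y p))"
proof -
  have *: "act \<phi> (act \<phi> Y) = (\<lambda>q. Y q - \<eta> q (Y q) *\<^sub>R \<xi> q)"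
    by (rule ext) (simp add: phi_phi)
  show ?thesis
    unfolding *
    using nabla_diff[OF U(1) smooth_xi U(3) smooth_vf_scale[OF U(1) smooth_eta[OF U(1,3)] smooth_xi] U(2)]
      nabla_scale[OF U(1) smooth_xi smooth_xi smooth_eta[OF U(1,3)] U(2)]
    by (simp add: phi_phi nabla_xi_xi deriv_eta_xi[OF U])
qed

lemma shape_phi_phi:
  assumes U: "open U" "p \<in> U" "smooth_vf A U Y"
  shows "nabla (act \<phi> (act \<phi> Y)) \<xi> p = nabla Y \<xi> p"
proof -
  have *: "act \<phi> (act \<phi> Y) = (\<lambda>q. Y q - \<eta> q (Y q) *\<^sub>R \<xi> q)"
    by (rule ext) (simp add: phi_phi)
  show ?thesis
    unfolding *
    using nabla_diff_left[OF U(1,3) smooth_vf_scale[OF U(1) smooth_eta[OF U(1,3)] smooth_xi] smooth_xi U(2)]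
      nabla_scale_left[OF U(1) smooth_xi smooth_xi smooth_eta[OF U(1,3)] U(2)]
    by (simp add: nabla_xi_xi)
qed

text \<open>Replacing \<open>Y\<close> by \<open>\<phi> Y\<close> in \<open>d_fundamental_xi\<close> and applying \<open>\<phi>\<close> gives the same equation with the opposite
  sign of \<open>B = (nabla\<^sub>\<xi> \<phi>) Y\<close>, hence \<open>B = 0\<close>.\<close>
lemma nabla_xi_phi:
  assumes U: "open U" "p \<in> U" "smooth_vf A U Y"
  shows "nabla \<xi> (act \<phi> Y) p = \<phi> p (nabla \<xi> Y p)"
proof -
  note fY = smooth_phi[OF U(1,3)]
  define B where "B = nabla \<xi> (act \<phi> Y) p - \<phi> p (nabla \<xi> Y p)"
  have "\<eta> p B = 0"
    using eta_nabla_xi[OF U(1,2) fY] by (simp add: B_def eta_simps eta_phi)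
  then have B: "\<phi> p (\<phi> p B) = B" by (simp add: phi_phi)
  have 1: "B + \<phi> p (nabla Y \<xi> p) + nabla (act \<phi> Y) \<xi> p = (2 * \<alpha>) *\<^sub>R \<phi> p (Y p)"
    using d_fundamental_xi[OF U] by (simp add: B_def)
  have "- \<phi> p B + \<phi> p (nabla (act \<phi> Y) \<xi> p) + nabla Y \<xi> p = (2 * \<alpha>) *\<^sub>R \<phi> p (\<phi> p (Y p))"
    using d_fundamental_xi[OF U(1,2) fY] unfolding nabla_xi_phi_phi[OF U] shape_phi_phi[OF U]
    by (simp add: B_def phi_simps)
  then have "\<phi> p (- \<phi> p B + \<phi> p (nabla (act \<phi> Y) \<xi> p) + nabla Y \<xi> p)
      = \<phi> p ((2 * \<alpha>) *\<^sub>R \<phi> p (\<phi> p (Y p)))" by (rule arg_cong)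
  then have "- B + nabla (act \<phi> Y) \<xi> p + \<phi> p (nabla Y \<xi> p) = (2 * \<alpha>) *\<^sub>R \<phi> p (Y p)"
    by (simp add: phi_simps B) (simp add: phi_phi phi_simps phi_xi eta_shape[OF U(1,2) fY])
  then have "B + B = 0" using 1 by (simp add: algebra_simps)
  then show ?thesis by (simp add: B_def flip: scaleR_2)
qed

lemma shape_phi:
  assumes U: "open U" "p \<in> U" "smooth_vf A U Y"
  shows "nabla (act \<phi> Y) \<xi> p = (2 * \<alpha>) *\<^sub>R \<phi> p (Y p) - \<phi> p (nabla Y \<xi> p)"
  using d_fundamental_xi[OF U] nabla_xi_phi[OF U] by (simp add: algebra_simps)

section \<open>The tensor field h\<close>

abbreviation h :: "('m, 'k) vfield \<Rightarrow> ('m, 'k) vfield" where "h \<equiv> structure_h A \<phi> \<xi>"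

lemma h_eq:
  assumes U: "open U" "p \<in> U" "smooth_vf A U X"
  shows "h X p = \<phi> p (nabla X \<xi> p) - \<alpha> *\<^sub>R \<phi> p (X p)"
proof -
  note fX = smooth_phi[OF U(1,3)]
  show ?thesis
    unfolding structure_h_def lie_deriv11_def act_apply phi_simps lie_bracket_eq[OF U(1) smooth_xi U(3,2)]
      lie_bracket_eq[OF U(1) smooth_xi fX U(2)] shape_phi[OF U] nabla_xi_phi[OF U]
    by (simp add: vec_eq_iff algebra_simps)
qed

lemma h_eq_field: "q \<in> U \<Longrightarrow> open U \<Longrightarrow> smooth_vf A U X \<Longrightarrow>
    h X q = act \<phi> (nabla X \<xi>) q - \<alpha> *\<^sub>R act \<phi> X q"
  by (simp add: h_eq)

lemma smooth_h:
  assumes "open U" "smooth_vf A U X"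
  shows "smooth_vf A U (h X)"
proof (rule smooth_vf_cong[OF assms(1)])
  show "smooth_vf A U (\<lambda>q. act \<phi> (nabla X \<xi>) q - \<alpha> *\<^sub>R act \<phi> X q)"
    by (intro smooth_intros assms)
qed (rule h_eq_field[OF _ assms])

lemma phi_h_eq:
  assumes U: "open U" "p \<in> U" "smooth_vf A U X"
  shows "\<phi> p (h X p) = nabla X \<xi> p - \<alpha> *\<^sub>R X p + (\<alpha> * \<eta> p (X p)) *\<^sub>R \<xi> p"
  by (simp add: h_eq[OF U] phi_simps phi_phi eta_shape[OF U] algebra_simps)

text \<open>With \<open>h = \<phi> L - \<alpha> \<phi>\<close> and \<open>L \<phi> = 2 \<alpha> \<phi> - \<phi> L\<close> one gets \<open>h\<^sup>2 = 2 \<alpha> L - L\<^sup>2 - \<alpha>\<^sup>2 \<phi>\<^sup>2\<close>. The powers of \<open>L\<close>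
  appear as nested covariant derivatives of \<open>\<xi>\<close>.\<close>
lemma h_h_eq:
  assumes U: "open U" "p \<in> U" "smooth_vf A U X"
  shows "h (h X) p = (2 * \<alpha>) *\<^sub>R nabla X \<xi> p - nabla (nabla X \<xi>) \<xi> p - \<alpha>\<^sup>2 *\<^sub>R \<phi> p (\<phi> p (X p))"
proof -
  note fX = smooth_phi[OF U(1,3)]
  have AX: "smooth_vf A U (nabla X \<xi>)" by (intro smooth_intros U)
  note fAX = smooth_phi[OF U(1) AX]
  have "nabla (h X) \<xi> p = nabla (\<lambda>q. act \<phi> (nabla X \<xi>) q - \<alpha> *\<^sub>R act \<phi> X q) \<xi> p"
    by (rule nabla_local[OF U(1,2) smooth_h[OF U(1,3)] smooth_xi]) (use h_eq_field U in auto)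
  also have "\<dots> = nabla (act \<phi> (nabla X \<xi>)) \<xi> p - \<alpha> *\<^sub>R nabla (act \<phi> X) \<xi> p"
    using nabla_diff_left[OF U(1) fAX smooth_vf_scale_const[OF U(1) fX] smooth_xi U(2)]
      nabla_scale_left[OF U(1) fX smooth_xi smooth_fun_const[OF U(1)] U(2)] by simp
  finally have AhX: "nabla (h X) \<xi> p = (2 * \<alpha>) *\<^sub>R \<phi> p (nabla X \<xi> p) - \<phi> p (nabla (nabla X \<xi>) \<xi> p)
      - \<alpha> *\<^sub>R ((2 * \<alpha>) *\<^sub>R \<phi> p (X p) - \<phi> p (nabla X \<xi> p))"
    using shape_phi[OF U(1,2) AX] shape_phi[OF U] by simp
  have e: "\<phi> p (\<phi> p (nabla X \<xi> p)) = nabla X \<xi> p"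
    "\<phi> p (\<phi> p (nabla (nabla X \<xi>) \<xi> p)) = nabla (nabla X \<xi>) \<xi> p"
    by (simp_all add: phi_phi eta_shape[OF U] eta_shape[OF U(1,2) AX])
  show ?thesis
    unfolding h_eq[OF U(1,2) smooth_h[OF U(1,3)]] h_eq[OF U] AhX phi_simps e
    by (simp add: vec_eq_iff algebra_simps power2_eq_square)
qed

section \<open>Curvature in the direction of the characteristic vector field\<close>

text \<open>As \<open>L \<xi> = 0\<close> everywhere, \<open>(nabla\<^sub>X L) \<xi>\<close> reduces to \<open>- L\<^sup>2 X\<close>.\<close>
lemma curvature_xi:
  assumes U: "open U" "p \<in> U" "smooth_vf A U X"
  shows "curvature A nabla \<xi> X \<xi> p = nabla2 \<xi> X \<xi> p + nabla (nabla X \<xi>) \<xi> p"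
  using curvature_eq_nabla2[OF U(1) smooth_xi U(3) smooth_xi U(2)] nabla_zero[OF U(1,3,2)]
  by (simp add: nabla2_def[of X] nabla_xi_xi)

lemma curvature_antisym:
  assumes "open U" "p \<in> U" "smooth_vf A U X" "smooth_vf A U Y" "smooth_vf A U Z"
  shows "curvature A nabla X Y Z p = - curvature A nabla Y X Z p"
  using curvature_eq_nabla2[OF assms(1,3,4,5,2)] curvature_eq_nabla2[OF assms(1,4,3,5,2)] by simp

lemma eta_nabla2:
  assumes U: "open U" "p \<in> U" "smooth_vf A U X"
  shows "\<eta> p (nabla2 \<xi> X \<xi> p) = 0"
proof -
  have s: "smooth_vf A U (nabla X \<xi>)" "smooth_vf A U (nabla \<xi> X)" by (intro smooth_intros U)+
  show ?thesis
    using eta_nabla_xi[OF U(1,2) s(1)] eta_shape[OF U(1) _ U(3)] eta_shape[OF U(1,2) s(2)]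
    by (simp add: nabla2_def eta_simps)
qed

text \<open>Both \<open>\<phi>\<close> and \<open>\<alpha> \<phi>\<close> are parallel along \<open>\<xi>\<close>, so only the factor \<open>L\<close> in \<open>h = \<phi> L - \<alpha> \<phi>\<close> is
  differentiated.\<close>
lemma nabla_xi_h:
  assumes U: "open U" "p \<in> U" "smooth_vf A U X"
  shows "cov_deriv11 nabla \<xi> h X p = \<phi> p (nabla2 \<xi> X \<xi> p)"
proof -
  have s: "smooth_vf A U (nabla X \<xi>)" "smooth_vf A U (act \<phi> X)" "smooth_vf A U (nabla \<xi> X)"
    by (intro smooth_intros U)+
  have "nabla \<xi> (h X) p = nabla \<xi> (\<lambda>q. act \<phi> (nabla X \<xi>) q - \<alpha> *\<^sub>R act \<phi> X q) p"
    by (rule nabla_local[OF U(1,2) smooth_xi smooth_h[OF U(1,3)]]) (use h_eq_field U in auto)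
  also have "\<dots> = \<phi> p (nabla \<xi> (nabla X \<xi>) p) - \<alpha> *\<^sub>R \<phi> p (nabla \<xi> X p)"
    using nabla_diff[OF U(1) smooth_xi smooth_phi[OF U(1) s(1)] smooth_vf_scale_const[OF U(1) s(2)] U(2)]
      nabla_scale_const[OF U(1) smooth_xi s(2) U(2)] nabla_xi_phi[OF U] nabla_xi_phi[OF U(1,2) s(1)] by simp
  finally show ?thesis
    by (simp add: cov_deriv11_def nabla2_def phi_simps h_eq[OF U(1,2) s(3)])
qed

text \<open>Differentiating \<open>L \<phi> = 2 \<alpha> \<phi> - \<phi> L\<close> along \<open>\<xi>\<close> shows that \<open>nabla\<^sub>\<xi> L\<close> anticommutes with \<open>\<phi>\<close>;
  applying the relation twice gives \<open>L\<^sup>2 \<phi> = 4 \<alpha>\<^sup>2 \<phi> - 4 \<alpha> \<phi> L + \<phi> L\<^sup>2\<close>.\<close>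
lemma nabla2_xi_phi:
  assumes U: "open U" "p \<in> U" "smooth_vf A U X"
  shows "nabla2 \<xi> (act \<phi> X) \<xi> p = - \<phi> p (nabla2 \<xi> X \<xi> p)"
    and "nabla (nabla (act \<phi> X) \<xi>) \<xi> p = (4 * \<alpha>\<^sup>2) *\<^sub>R \<phi> p (X p) - (4 * \<alpha>) *\<^sub>R \<phi> p (nabla X \<xi> p)
      + \<phi> p (nabla (nabla X \<xi>) \<xi> p)"
proof -
  have s: "smooth_vf A U (nabla X \<xi>)" "smooth_vf A U (act \<phi> X)" "smooth_vf A U (nabla \<xi> X)"
    by (intro smooth_intros U)+
  have t: "smooth_vf A U (act \<phi> (nabla X \<xi>))" "smooth_vf A U (\<lambda>q. (2 * \<alpha>) *\<^sub>R act \<phi> X q)"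
    "smooth_vf A U (nabla (act \<phi> X) \<xi>)" "smooth_vf A U (nabla \<xi> (act \<phi> X))"
    by (intro smooth_intros U s)+
  have A: "nabla (act \<phi> X) \<xi> q = (2 * \<alpha>) *\<^sub>R act \<phi> X q - act \<phi> (nabla X \<xi>) q" if "q \<in> U" for q
    using shape_phi[OF U(1) that U(3)] by simp
  have "nabla \<xi> (nabla (act \<phi> X) \<xi>) p = nabla \<xi> (\<lambda>q. (2 * \<alpha>) *\<^sub>R act \<phi> X q - act \<phi> (nabla X \<xi>) q) p"
    by (rule nabla_local[OF U(1,2) smooth_xi t(3)]) (use A in auto)
  also have "\<dots> = (2 * \<alpha>) *\<^sub>R \<phi> p (nabla \<xi> X p) - \<phi> p (nabla \<xi> (nabla X \<xi>) p)"
    using nabla_diff[OF U(1) smooth_xi t(2,1) U(2)] nabla_scale_const[OF U(1) smooth_xi s(2) U(2)]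
      nabla_xi_phi[OF U] nabla_xi_phi[OF U(1,2) s(1)] by simp
  finally have 1: "nabla \<xi> (nabla (act \<phi> X) \<xi>) p = \<dots>" .
  have "nabla (nabla \<xi> (act \<phi> X)) \<xi> p = nabla (act \<phi> (nabla \<xi> X)) \<xi> p"
    by (rule nabla_local[OF U(1,2) t(4) smooth_xi]) (use nabla_xi_phi[OF U(1) _ U(3)] in auto)
  also have "\<dots> = (2 * \<alpha>) *\<^sub>R \<phi> p (nabla \<xi> X p) - \<phi> p (nabla (nabla \<xi> X) \<xi> p)"
    by (rule shape_phi[OF U(1,2) s(3)])
  finally show "nabla2 \<xi> (act \<phi> X) \<xi> p = - \<phi> p (nabla2 \<xi> X \<xi> p)"
    using 1 by (simp add: nabla2_def phi_simps)
  have "nabla (nabla (act \<phi> X) \<xi>) \<xi> p = nabla (\<lambda>q. (2 * \<alpha>) *\<^sub>R act \<phi> X q - act \<phi> (nabla X \<xi>) q) \<xi> p"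
    by (rule nabla_local[OF U(1,2) t(3) smooth_xi]) (use A in auto)
  also have "\<dots> = (2 * \<alpha>) *\<^sub>R nabla (act \<phi> X) \<xi> p - nabla (act \<phi> (nabla X \<xi>)) \<xi> p"
    using nabla_diff_left[OF U(1) t(2,1) smooth_xi U(2)]
      nabla_scale_left[OF U(1) s(2) smooth_xi smooth_fun_const[OF U(1)] U(2)] by simp
  also have "\<dots> = (4 * \<alpha>\<^sup>2) *\<^sub>R \<phi> p (X p) - (4 * \<alpha>) *\<^sub>R \<phi> p (nabla X \<xi> p)
      + \<phi> p (nabla (nabla X \<xi>) \<xi> p)"
    unfolding shape_phi[OF U] shape_phi[OF U(1,2) s(1)]
    by (simp add: vec_eq_iff algebra_simps power2_eq_square)
  finally show "nabla (nabla (act \<phi> X) \<xi>) \<xi> p = (4 * \<alpha>\<^sup>2) *\<^sub>R \<phi> p (X p) - (4 * \<alpha>) *\<^sub>R \<phi> p (nabla X \<xi> p)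
      + \<phi> p (nabla (nabla X \<xi>) \<xi> p)" .
qed

theorem curvature_formula:
  assumes U: "open U" "p \<in> U" "smooth_vf A U X"
  shows "curvature A nabla \<xi> X \<xi> p = \<alpha>\<^sup>2 *\<^sub>R \<phi> p (\<phi> p (X p)) + (2 * \<alpha>) *\<^sub>R \<phi> p (h X p) - h (h X) p
    + \<phi> p (cov_deriv11 nabla \<xi> h X p)"
proof -
  have "\<phi> p (cov_deriv11 nabla \<xi> h X p) = nabla2 \<xi> X \<xi> p"
    by (simp add: nabla_xi_h[OF U] phi_phi eta_nabla2[OF U])
  then show ?thesis
    unfolding curvature_xi[OF U] h_h_eq[OF U] phi_h_eq[OF U] phi_phi by (simp add: vec_eq_iff algebra_simps power2_eq_square)
qed

theorem nabla_xi_h_formula: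
  assumes U: "open U" "p \<in> U" "smooth_vf A U X"
  shows "cov_deriv11 nabla \<xi> h X p = - (\<alpha>\<^sup>2 *\<^sub>R \<phi> p (X p)) - (2 * \<alpha>) *\<^sub>R h X p + \<phi> p (h (h X) p)
    - \<phi> p (curvature A nabla X \<xi> \<xi> p)"
proof -
  have e: "\<eta> p (h X p) = 0" "\<eta> p (cov_deriv11 nabla \<xi> h X p) = 0"
    by (simp_all add: h_eq[OF U] nabla_xi_h[OF U] eta_simps eta_phi)
  have "\<phi> p (curvature A nabla X \<xi> \<xi> p) = - \<phi> p (curvature A nabla \<xi> X \<xi> p)"
    using curvature_antisym[OF U smooth_xi smooth_xi] by (simp add: phi_simps)
  then show ?thesis
    unfolding curvature_formula[OF U]
    by (simp add: phi_simps phi_phi[of p "h X p"] phi_phi[of p "cov_deriv11 nabla \<xi> h X p"] e)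
       (simp add: phi_phi phi_simps phi_xi)
qed

text \<open>Averaging \<open>R(\<xi>,-)\<xi>\<close> with its conjugate by \<open>\<phi>\<close> removes the anticommuting part \<open>nabla\<^sub>\<xi> L\<close> and leaves
  algebra in \<open>L\<close> and \<open>\<phi>\<close>.\<close>
theorem curvature_average:
  assumes U: "open U" "p \<in> U" "smooth_vf A U X"
  shows "(1 / 2) *\<^sub>R (curvature A nabla \<xi> X \<xi> p + \<phi> p (curvature A nabla \<xi> (act \<phi> X) \<xi> p))
    = \<alpha>\<^sup>2 *\<^sub>R \<phi> p (\<phi> p (X p)) - h (h X) p"
proof -
  have s: "smooth_vf A U (nabla X \<xi>)" "smooth_vf A U (act \<phi> X)" by (intro smooth_intros U)+
  have e: "\<phi> p (\<phi> p (nabla2 \<xi> X \<xi> p)) = nabla2 \<xi> X \<xi> p"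
    "\<phi> p (\<phi> p (nabla X \<xi> p)) = nabla X \<xi> p"
    "\<phi> p (\<phi> p (nabla (nabla X \<xi>) \<xi> p)) = nabla (nabla X \<xi>) \<xi> p"
    by (simp_all add: phi_phi eta_nabla2[OF U] eta_shape[OF U] eta_shape[OF U(1,2) s(1)])
  have "curvature A nabla \<xi> X \<xi> p + \<phi> p (curvature A nabla \<xi> (act \<phi> X) \<xi> p)
      = 2 *\<^sub>R (\<alpha>\<^sup>2 *\<^sub>R \<phi> p (\<phi> p (X p)) - h (h X) p)"
    unfolding curvature_xi[OF U] curvature_xi[OF U(1,2) s(2)] nabla2_xi_phi[OF U] h_h_eq[OF U]
    unfolding phi_simps e by (simp add: vec_eq_iff algebra_simps)
  then show ?thesis by simp
qed

section \<open>Ricci curvature\<close>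

lemma trace_phi_phi: "trace (matrix (\<lambda>v. \<phi> p (\<phi> p v))) = 2 * real n"
proof -
  have "trace (matrix (\<lambda>v. \<phi> p (\<phi> p v)))
      = trace (matrix (\<lambda>v :: real ^ 'k. v)) - trace (matrix (\<lambda>v. \<eta> p v *\<^sub>R \<xi> p))"
    by (simp add: phi_phi trace_matrix sum_subtractf)
  then show ?thesis
    using trace_matrix_rank_one[OF eta_linear] card by (simp add: eta_xi) (simp add: trace_matrix axis_def)
qed

text \<open>Cyclicity of the trace turns the conjugate into \<open>L \<circ> \<phi>\<^sup>2\<close>, which is \<open>L\<close> because \<open>\<phi>\<^sup>2\<close> is the
  identity up to a multiple of \<open>\<xi>\<close>.\<close>
lemma trace_conjugate_phi:
  assumes L: "linear L" "L (\<xi> p) = 0"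
  shows "trace (matrix (\<lambda>v. \<phi> p (L (\<phi> p v)))) = trace (matrix L)"
proof -
  have "linear (\<lambda>v. L (\<phi> p v))"
    using linear_compose[OF phi_linear L(1)] by (simp add: comp_def)
  then have "trace (matrix (\<lambda>v. \<phi> p (L (\<phi> p v)))) = trace (matrix (\<lambda>v. L (\<phi> p (\<phi> p v))))"
    by (rule trace_matrix_compose[OF phi_linear])
  also have "(\<lambda>v. L (\<phi> p (\<phi> p v))) = L"
    using L by (simp add: phi_phi linear_diff linear_scale)
  finally show ?thesis .
qed

lemma extend_nbhd: "open (cdom (pref p))" "p \<in> cdom (pref p)" "smooth_vf A (cdom (pref p)) (extend A p v)"
  by (simp_all add: open_cdom chart_at smooth_extend)

text \<open>Composing \<open>\<phi> L + L \<phi> = 2 \<alpha> \<phi>\<close> with \<open>\<phi>\<close> gives \<open>L + \<phi> L \<phi> = 2 \<alpha> \<phi>\<^sup>2\<close>. Both summands on the left have the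
  same trace, and \<open>tr \<phi>\<^sup>2 = 2 n\<close>.\<close>
lemma trace_shape: "trace (matrix (\<lambda>v. nabla (extend A p v) \<xi> p)) = 2 * real n * \<alpha>"
proof -
  define L where "L v = nabla (extend A p v) \<xi> p" for v
  note ten = nabla_tensorial[OF extend_nbhd(1,2)[of p] smooth_xi]
  have L: "linear L" unfolding L_def[abs_def] by (rule tensorial_at_linear[OF ten])
  have "L (\<xi> p) = 0"
    using tensorial_at_value[OF ten extend_nbhd(1,2) smooth_xi] by (simp add: L_def nabla_xi_xi)
  note conj = trace_conjugate_phi[OF L this]
  have "\<phi> p (L (\<phi> p v)) = (2 * \<alpha>) *\<^sub>R \<phi> p (\<phi> p v) - L v" for v
  proof -
    note E = extend_nbhd(1,2)[of p] extend_nbhd(3)[of p v]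
    have "L (\<phi> p v) = nabla (act \<phi> (extend A p v)) \<xi> p"
      using tensorial_at_value[OF ten E(1,2) smooth_phi[OF E(1,3)]] by (simp add: L_def extend_at)
    then show ?thesis
      using shape_phi[OF E] eta_shape[OF E]
      by (simp add: L_def extend_at phi_simps phi_phi[of p "nabla (extend A p v) \<xi> p"])
  qed
  then have "trace (matrix (\<lambda>v. \<phi> p (L (\<phi> p v))))
      = (2 * \<alpha>) * trace (matrix (\<lambda>v. \<phi> p (\<phi> p v))) - trace (matrix L)"
    by (simp add: trace_matrix sum_subtractf sum_distrib_left)
  then have "trace (matrix L) = 2 * real n * \<alpha>" using conj by (simp add: trace_phi_phi)
  then show ?thesis by (simp add: L_def[abs_def])
qed

text \<open>The operator \<open>K = R(-,\<xi>)\<xi>\<close> and its conjugate by \<open>\<phi>\<close> have equal traces, so the trace of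
  \<open>curvature_average\<close> determines \<open>tr K\<close>.\<close>
theorem ricci_xi_xi:
  "ricci A nabla \<xi> \<xi> p = - 2 * real n * \<alpha>\<^sup>2 + tensor_trace A (h \<circ> h) p"
proof -
  define K where "K v = curvature A nabla (extend A p v) \<xi> \<xi> p" for v
  note ten = curvature_tensorial[OF extend_nbhd(1,2)[of p] smooth_xi smooth_xi]
  have K: "linear K" unfolding K_def[abs_def] by (rule tensorial_at_linear[OF ten])
  have "K (\<xi> p) = 0"
    using tensorial_at_value[OF ten extend_nbhd(1,2) smooth_xi]
      curvature_eq_nabla2[OF extend_nbhd(1)[of p] smooth_xi smooth_xi smooth_xi extend_nbhd(2)]
    by (simp add: K_def)
  note conj = trace_conjugate_phi[OF K this]
  have "(h \<circ> h) (extend A p v) p = \<alpha>\<^sup>2 *\<^sub>R \<phi> p (\<phi> p v) + (1 / 2) *\<^sub>R (K v + \<phi> p (K (\<phi> p v)))" for v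
  proof -
    note E = extend_nbhd(1,2)[of p] extend_nbhd(3)[of p v]
    have "K (\<phi> p v) = - curvature A nabla \<xi> (act \<phi> (extend A p v)) \<xi> p"
      using tensorial_at_value[OF ten E(1,2) smooth_phi[OF E(1,3)]]
        curvature_antisym[OF E(1,2) smooth_phi[OF E(1,3)] smooth_xi smooth_xi] by (simp add: K_def extend_at)
    moreover have "K v = - curvature A nabla \<xi> (extend A p v) \<xi> p"
      using curvature_antisym[OF E smooth_xi smooth_xi] by (simp add: K_def)
    ultimately show ?thesis
      using curvature_average[OF E] by (simp add: extend_at phi_simps algebra_simps)
  qed
  then have "tensor_trace A (h \<circ> h) p = \<alpha>\<^sup>2 * trace (matrix (\<lambda>v. \<phi> p (\<phi> p v)))
      + (1 / 2) * (trace (matrix K) + trace (matrix (\<lambda>v. \<phi> p (K (\<phi> p v)))))"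
    by (simp only: tensor_trace_def trace_matrix_add trace_matrix_scale)
  also have "\<dots> = 2 * real n * \<alpha>\<^sup>2 + trace (matrix K)"
    by (simp add: conj trace_phi_phi)
  also have "trace (matrix K) = ricci A nabla \<xi> \<xi> p"
    by (simp add: ricci_def tensor_trace_def K_def[abs_def])
  finally show ?thesis by linarith
qed

text \<open>The derivative of \<open>g (L X) Z = g (L Z) X\<close> along \<open>Y\<close>: the terms that contain derivatives of \<open>X\<close> and \<open>Z\<close> match by
  the same symmetry.\<close>
lemma nabla2_symmetric:
  assumes U: "open U" "p \<in> U" "smooth_vf A U X" "smooth_vf A U Y" "smooth_vf A U Z"
  shows "g p (nabla2 Y X \<xi> p) (Z p) = g p (nabla2 Y Z \<xi> p) (X p)"
proof -
  have s: "smooth_vf A U (nabla X \<xi>)" "smooth_vf A U (nabla Z \<xi>)" "smooth_vf A U (nabla Y X)"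
    "smooth_vf A U (nabla Y Z)"
    by (intro smooth_intros U)+
  have "vf_deriv A Y (\<lambda>q. g q (nabla X \<xi> q) (Z q)) p = vf_deriv A Y (\<lambda>q. g q (nabla Z \<xi> q) (X q)) p"
    by (rule vf_deriv_cong[OF U(1,2)]) (rule shape_symmetric[OF U(1) _ U(3,5)])
  then show ?thesis
    using vf_deriv_metric[OF U(1,4) s(1) U(5,2)] vf_deriv_metric[OF U(1,4) s(2) U(3,2)]
      shape_symmetric[OF U(1,2,3) s(4)] shape_symmetric[OF U(1,2,5) s(3)]
    by (simp add: nabla2_def g_simps)
qed

lemma frame_shape_trace:
  assumes U: "open U" "p \<in> U" and E: "\<And>i. smooth_vf A U (E i)" "pseudo_orthonormal (g p) (\<lambda>i. E i p)"
  shows "(\<Sum>i\<in>UNIV. g p (E i p) (E i p) * g p (nabla (E i) \<xi> p) (E i p)) = 2 * real n * \<alpha>"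
proof -
  note ten = nabla_tensorial[OF U smooth_xi]
  show ?thesis
    using trace_shape[of p] trace_pseudo_orthonormal[OF g_bilinear E(2) tensorial_at_linear[OF ten]]
      tensorial_at_value[OF ten U E(1)] by simp
qed

text \<open>The functions \<open>g (E i) (E i)\<close> take only the values \<open>1\<close> and \<open>- 1\<close>. Instead of an argument that they are
  locally constant, it suffices to differentiate the equation that their square is \<open>1\<close>.\<close>
lemma frame_inner_derivative:
  assumes U: "open U" "p \<in> U" "smooth_vf A U X"
    and E: "\<And>i. smooth_vf A U (E i)" "\<And>q. q \<in> U \<Longrightarrow> pseudo_orthonormal (g q) (\<lambda>i. E i q)"
  shows "vf_deriv A X (\<lambda>q. g q (E i q) (E j q)) p = 0"
proof (cases "i = j")
  case False
  then show ?thesis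
    using E(2) by (intro vf_deriv_locally_const[OF U(1,2), where c = 0]) (auto simp: pseudo_orthonormal_def)
next
  case True
  let ?f = "\<lambda>q. g q (E i q) (E i q)"
  have f: "smooth_fun A U ?f" by (intro smooth_intros U E)
  have "vf_deriv A X (\<lambda>q. ?f q * ?f q) p = 0"
    by (rule vf_deriv_locally_const[OF U(1,2)]) (rule pseudo_orthonormal_square[OF E(2)])
  then have "?f p * vf_deriv A X ?f p = 0"
    using vf_deriv_mult[OF U(1) f f U(2), of X] by simp
  moreover have "?f p \<noteq> 0"
    using pseudo_orthonormal_square[OF E(2)[OF U(2)], of i] by auto
  ultimately show ?thesis using True by simp
qed

text \<open>The trace of \<open>nabla\<^sub>X L\<close> is the derivative of the constant function \<open>tr L\<close>. In the frame, the correction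
  terms that come from differentiating the \<open>E i\<close> pair the symmetric matrix of \<open>L\<close> with the skew matrix
  of \<open>nabla\<^sub>X\<close>; their entries are the numbers \<open>c i j\<close>, and their sum is zero.\<close>
lemma trace_nabla2:
  assumes U: "open U" "p \<in> U" "smooth_vf A U X"
    and E: "\<And>i. smooth_vf A U (E i)" "\<And>q. q \<in> U \<Longrightarrow> pseudo_orthonormal (g q) (\<lambda>i. E i q)"
  shows "(\<Sum>i\<in>UNIV. g p (E i p) (E i p) * g p (nabla2 X (E i) \<xi> p) (E i p)) = 0"
proof -
  let ?\<epsilon> = "\<lambda>i q. g q (E i q) (E i q)" and ?a = "\<lambda>i q. g q (nabla (E i) \<xi> q) (E i q)"
  have s: "smooth_vf A U (nabla (E i) \<xi>)" "smooth_vf A U (nabla X (E i))" "smooth_fun A U (?\<epsilon> i)"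
    "smooth_fun A U (?a i)" "smooth_fun A U (\<lambda>q. ?\<epsilon> i q * ?a i q)" for i
    by (intro smooth_intros U E)+
  define c where "c i j = ?\<epsilon> i p * ?\<epsilon> j p * g p (nabla (E i) \<xi> p) (E j p) * g p (E j p) (nabla X (E i) p)" for i j
  have "c i j = - c j i" for i j
  proof -
    have "g p (nabla X (E i) p) (E j p) + g p (E i p) (nabla X (E j) p) = 0"
      using frame_inner_derivative[OF U E] vf_deriv_metric[OF U(1,3) E(1) E(1) U(2)] by simp
    then have "g p (E j p) (nabla X (E i) p) = - g p (E i p) (nabla X (E j) p)"
      using g_sym[of p "E j p"] by simp
    then show ?thesis
      using shape_symmetric[OF U(1,2) E(1) E(1), of i j] by (simp add: c_def)
  qed
  then have "(\<Sum>i\<in>UNIV. \<Sum>j\<in>UNIV. c i j) = (\<Sum>i\<in>UNIV. \<Sum>j\<in>UNIV. - c j i)"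
    by (intro sum.cong refl)
  also have "\<dots> = - (\<Sum>i\<in>UNIV. \<Sum>j\<in>UNIV. c j i)"
    by (simp only: sum_negf)
  also have "(\<Sum>i\<in>UNIV. \<Sum>j\<in>UNIV. c j i) = (\<Sum>i\<in>UNIV. \<Sum>j\<in>UNIV. c i j)"
    by (rule sum.swap)
  finally have c0: "(\<Sum>i\<in>UNIV. \<Sum>j\<in>UNIV. c i j) = 0" by simp
  have row: "?\<epsilon> i p * g p (nabla (E i) \<xi> p) (nabla X (E i) p) = (\<Sum>j\<in>UNIV. c i j)" for i
  proof -
    have "g p (nabla (E i) \<xi> p) (nabla X (E i) p)
        = g p (\<Sum>j\<in>UNIV. (?\<epsilon> j p * g p (nabla (E i) \<xi> p) (E j p)) *\<^sub>R E j p) (nabla X (E i) p)"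
      using pseudo_orthonormal_expansion[OF g_bilinear E(2)[OF U(2)], of "nabla (E i) \<xi> p"]
      by (rule arg_cong)
    then show ?thesis
      by (simp add: c_def g_simps sum_distrib_left mult.assoc)
  qed
  have "0 = vf_deriv A X (\<lambda>q. \<Sum>i\<in>UNIV. ?\<epsilon> i q * ?a i q) p"
    by (rule vf_deriv_locally_const[OF U(1,2), symmetric]) (rule frame_shape_trace[OF U(1) _ E])
  also have "\<dots> = (\<Sum>i\<in>UNIV. vf_deriv A X (\<lambda>q. ?\<epsilon> i q * ?a i q) p)"
    by (rule vf_deriv_sum[OF U(1,2) finite s(5)])
  also have "\<dots> = (\<Sum>i\<in>UNIV. ?\<epsilon> i p * g p (nabla2 X (E i) \<xi> p) (E i p) + 2 * (\<Sum>j\<in>UNIV. c i j))"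
  proof (rule sum.cong[OF refl])
    fix i
    have "vf_deriv A X (\<lambda>q. ?\<epsilon> i q * ?a i q) p = ?\<epsilon> i p * vf_deriv A X (?a i) p"
      using vf_deriv_mult[OF U(1) s(3,4) U(2), of X] frame_inner_derivative[OF U E] by simp
    also have "vf_deriv A X (?a i) p = g p (nabla2 X (E i) \<xi> p) (E i p)
        + 2 * g p (nabla (E i) \<xi> p) (nabla X (E i) p)"
      using vf_deriv_metric[OF U(1,3) s(1) E(1) U(2)] shape_symmetric[OF U(1,2) E(1) s(2)]
      by (simp add: nabla2_def g_simps)
    finally show "vf_deriv A X (\<lambda>q. ?\<epsilon> i q * ?a i q) p
        = ?\<epsilon> i p * g p (nabla2 X (E i) \<xi> p) (E i p) + 2 * (\<Sum>j\<in>UNIV. c i j)"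
      unfolding row[symmetric] by (simp add: algebra_simps)
  qed
  also have "\<dots> = (\<Sum>i\<in>UNIV. ?\<epsilon> i p * g p (nabla2 X (E i) \<xi> p) (E i p))"
    using c0 by (simp add: sum.distrib flip: sum_distrib_left)
  finally show ?thesis by simp
qed

text \<open>One term of the divergence of \<open>\<phi> h = L - \<alpha> Id + \<alpha> \<eta> \<otimes> \<xi>\<close>; the second summand on the right is \<open>\<alpha>\<close> times
  the derivative of \<open>\<eta> \<otimes> \<xi>\<close>.\<close>
lemma cov_deriv_phi_h:
  assumes U: "open U" "p \<in> U" "smooth_vf A U Y"
  shows "cov_deriv11 nabla Y (act \<phi> \<circ> h) Y p = nabla2 Y Y \<xi> p
    + \<alpha> *\<^sub>R (g p (nabla Y \<xi> p) (Y p) *\<^sub>R \<xi> p + \<eta> p (Y p) *\<^sub>R nabla Y \<xi> p)"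
proof -
  let ?f = "\<lambda>q. \<alpha> * \<eta> q (Y q)"
  have s: "smooth_vf A U (nabla Y \<xi>)" "smooth_vf A U (\<lambda>q. \<alpha> *\<^sub>R Y q)" "smooth_fun A U (\<lambda>q. \<eta> q (Y q))"
    "smooth_vf A U (nabla Y Y)" "smooth_vf A U (act \<phi> (h Y))" "smooth_fun A U ?f"
    "smooth_vf A U (\<lambda>q. nabla Y \<xi> q - \<alpha> *\<^sub>R Y q)" "smooth_vf A U (\<lambda>q. ?f q *\<^sub>R \<xi> q)"
    by (intro smooth_intros smooth_h U)+
  have d: "vf_deriv A Y ?f p = \<alpha> * (\<eta> p (nabla Y Y p) + g p (nabla Y \<xi> p) (Y p))"
    using vf_deriv_mult[OF U(1) smooth_fun_const[OF U(1), of \<alpha>] s(3) U(2)] deriv_eta[OF U(1,2,3,3)]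
    by (simp add: vf_deriv_const)
  have "nabla Y (act \<phi> (h Y)) p = nabla Y (\<lambda>q. (nabla Y \<xi> q - \<alpha> *\<^sub>R Y q) + ?f q *\<^sub>R \<xi> q) p"
    by (rule nabla_local[OF U s(5)]) (use phi_h_eq[OF U(1) _ U(3)] in auto)
  also have "\<dots> = nabla Y (nabla Y \<xi>) p - \<alpha> *\<^sub>R nabla Y Y p
      + (vf_deriv A Y ?f p *\<^sub>R \<xi> p + ?f p *\<^sub>R nabla Y \<xi> p)"
    using nabla_add[OF U(1,3) s(7,8) U(2)] nabla_diff[OF U(1,3) s(1,2) U(2)]
      nabla_scale_const[OF U(1,3,3,2)] nabla_scale[OF U(1,3) smooth_xi s(6) U(2)] by simp
  finally show ?thesis
    by (simp add: cov_deriv11_def phi_h_eq[OF U(1,2) s(4)] d nabla2_def algebra_simps)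
qed

text \<open>Summing \<open>cov_deriv_phi_h\<close> over the frame, the derivative of \<open>\<eta> \<otimes> \<xi>\<close> contributes
  \<open>\<alpha> (tr L) \<eta> X = 2 n \<alpha>\<^sup>2 \<eta> X\<close> and a term \<open>\<alpha> g (L \<xi>) X = 0\<close>. What remains of the divergence is the trace
  of \<open>(nabla\<^sub>Y L) Y\<close>, and this is the trace of \<open>R(-,X)\<xi>\<close> by \<open>nabla2_symmetric\<close> and \<open>trace_nabla2\<close>.\<close>
theorem ricci_xi:
  assumes X: "smooth_vf A UNIV X"
  shows "ricci A nabla X \<xi> p
    = - 2 * real n * \<alpha>\<^sup>2 * \<eta> p (X p) + g p (divergence11 A g nabla (act \<phi> \<circ> h) p) (X p)"
proof -
  obtain U E where U: "p \<in> U" "open U" and E: "\<And>i. smooth_vf A U (E i)"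
    "\<And>q. q \<in> U \<Longrightarrow> pseudo_orthonormal (g q) (\<lambda>i. E i q)"
    and div: "\<And>F. divergence11 A g nabla F p
      = (\<Sum>i\<in>UNIV. g p (E i p) (E i p) *\<^sub>R cov_deriv11 nabla (E i) F (E i) p)"
    using divergence_frame[of p] by blast
  let ?\<epsilon> = "\<lambda>i. g p (E i p) (E i p)"
  have XU: "smooth_vf A U X" using X by (rule smooth_vf_subset) simp
  have AX: "smooth_vf A U (nabla X \<xi>)" by (intro smooth_intros U XU)
  note ten = curvature_tensorial[OF U(2,1) XU smooth_xi]
  have "ricci A nabla X \<xi> p = (\<Sum>i\<in>UNIV. ?\<epsilon> i * g p (curvature A nabla (E i) X \<xi> p) (E i p))"
    using trace_pseudo_orthonormal[OF g_bilinear E(2)[OF U(1)] tensorial_at_linear[OF ten]]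
      tensorial_at_value[OF ten U(2,1) E(1)] by (simp add: ricci_def tensor_trace_def)
  also have "\<dots> = (\<Sum>i\<in>UNIV. ?\<epsilon> i * g p (nabla2 (E i) (E i) \<xi> p) (X p)
      - ?\<epsilon> i * g p (nabla2 X (E i) \<xi> p) (E i p))"
    using curvature_eq_nabla2[OF U(2) E(1) XU smooth_xi U(1)] nabla2_symmetric[OF U(2,1) XU E(1) E(1)]
    by (simp add: g_simps right_diff_distrib)
  also have "\<dots> = (\<Sum>i\<in>UNIV. ?\<epsilon> i * g p (nabla2 (E i) (E i) \<xi> p) (X p))"
    using trace_nabla2[OF U(2,1) XU E] by (simp add: sum_subtractf)
  finally have 1: "ricci A nabla X \<xi> p = \<dots>" .
  have "(\<Sum>i\<in>UNIV. ?\<epsilon> i * \<eta> p (E i p) * g p (nabla (E i) \<xi> p) (X p)) = 0"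
  proof -
    have "0 = g p (nabla X \<xi> p) (\<xi> p)"
      using eta_shape[OF U(2,1) XU] by (simp add: eta_g)
    also have "\<dots> = g p (\<Sum>i\<in>UNIV. (?\<epsilon> i * g p (nabla X \<xi> p) (E i p)) *\<^sub>R E i p) (\<xi> p)"
      using pseudo_orthonormal_expansion[OF g_bilinear E(2)[OF U(1)], of "nabla X \<xi> p"]
      by (rule arg_cong)
    also have "\<dots> = (\<Sum>i\<in>UNIV. ?\<epsilon> i * \<eta> p (E i p) * g p (nabla (E i) \<xi> p) (X p))"
      using shape_symmetric[OF U(2,1) XU E(1)] by (simp add: g_simps eta_g ac_simps)
    finally show ?thesis by simp
  qed
  moreover have "g p (divergence11 A g nabla (act \<phi> \<circ> h) p) (X p)
      = (\<Sum>i\<in>UNIV. ?\<epsilon> i * g p (nabla2 (E i) (E i) \<xi> p) (X p)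
        + \<alpha> * \<eta> p (X p) * (?\<epsilon> i * g p (nabla (E i) \<xi> p) (E i p))
        + \<alpha> * (?\<epsilon> i * \<eta> p (E i p) * g p (nabla (E i) \<xi> p) (X p)))"
    using g_sym[of p "\<xi> p" "X p"]
    by (simp add: div cov_deriv_phi_h[OF U(2,1) E(1)] g_simps eta_g algebra_simps)
  ultimately have "g p (divergence11 A g nabla (act \<phi> \<circ> h) p) (X p)
      = (\<Sum>i\<in>UNIV. ?\<epsilon> i * g p (nabla2 (E i) (E i) \<xi> p) (X p)) + \<alpha> * \<eta> p (X p) * (2 * real n * \<alpha>)"
    using frame_shape_trace[OF U(2,1) E(1) E(2)[OF U(1)]]
    by (simp add: sum.distrib flip: sum_distrib_left)
  then show ?thesis using 1 by (simp add: power2_eq_square)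
qed

end

theorem theorem4:
  fixes A :: "('m::{t2_space, second_countable_topology}, 'k::finite) chart set"
    and n :: nat and \<alpha> :: real
    and \<phi> :: "'m \<Rightarrow> real ^ 'k \<Rightarrow> real ^ 'k"
    and \<xi> :: "('m, 'k) vfield"
    and \<eta> :: "'m \<Rightarrow> real ^ 'k \<Rightarrow> real"
    and g :: "'m \<Rightarrow> real ^ 'k \<Rightarrow> real ^ 'k \<Rightarrow> real"
    and nabla :: "('m, 'k) vfield \<Rightarrow> ('m, 'k) vfield \<Rightarrow> ('m, 'k) vfield"
    and R :: "('m, 'k) vfield \<Rightarrow> ('m, 'k) vfield \<Rightarrow> ('m, 'k) vfield \<Rightarrow> ('m, 'k) vfield"
    and S :: "('m, 'k) vfield \<Rightarrow> ('m, 'k) vfield \<Rightarrow> 'm \<Rightarrow> real"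
    and h :: "('m, 'k) vfield \<Rightarrow> ('m, 'k) vfield"
    and X :: "('m, 'k) vfield"
  assumes "almost_para_Kenmotsu A n \<alpha> \<phi> \<xi> \<eta> g"
    and "levi_civita A g nabla"
    and "R = curvature A nabla"
    and "S = ricci A nabla"
    and "h = structure_h A \<phi> \<xi>"
    and "smooth_vf A UNIV X"
  shows "\<forall>p.
      R \<xi> X \<xi> p = \<alpha>\<^sup>2 *\<^sub>R act \<phi> (act \<phi> X) p + (2 * \<alpha>) *\<^sub>R act \<phi> (h X) p - h (h X) p
                    + act \<phi> (cov_deriv11 nabla \<xi> h X) p
    \<and> cov_deriv11 nabla \<xi> h X p = - (\<alpha>\<^sup>2 *\<^sub>R act \<phi> X p) - (2 * \<alpha>) *\<^sub>R h X p + act \<phi> (h (h X)) p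
                    - act \<phi> (R X \<xi> \<xi>) p
    \<and> (1 / 2) *\<^sub>R (R \<xi> X \<xi> p + act \<phi> (R \<xi> (act \<phi> X) \<xi>) p)
                  = \<alpha>\<^sup>2 *\<^sub>R act \<phi> (act \<phi> X) p - h (h X) p
    \<and> S X \<xi> p = - 2 * real n * \<alpha>\<^sup>2 * \<eta> p (X p) + g p (divergence11 A g nabla (act \<phi> \<circ> h) p) (X p)
    \<and> S \<xi> \<xi> p = - 2 * real n * \<alpha>\<^sup>2 + tensor_trace A (h \<circ> h) p"
proof -
  interpret para_Kenmotsu_manifold A g n nabla \<phi> \<xi> \<eta> \<alpha>
    using assms(1,2)
    by unfold_locales (simp_all add: almost_para_Kenmotsu_def almost_paracontact_metric_def)
  show ?thesis
    unfolding assms(3-5)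
    by (simp only: act_apply, intro allI conjI curvature_formula[OF open_UNIV UNIV_I assms(6)]
        nabla_xi_h_formula[OF open_UNIV UNIV_I assms(6)] curvature_average[OF open_UNIV UNIV_I assms(6)]
        ricci_xi[OF assms(6)] ricci_xi_xi)
qed

end
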